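(* Let $H\subset\Gamma$ be a finitely generated subgroup, $\{1\}\ne H\ne\Gamma$. Then $H$ is generated by $H\cap[\![\mathbb X\mathbb Y]\!]_\Gamma$ if and only if $\Gamma/H$ is a generalized pseudo-tree without monovalent vertices (i.e. a skeleton $\mathrm{Sk}_{(\Xi,\ell)}$ with $\ell$ taking values in $\{0,\vartriangle\}$). If this is the case, $H$ admits a free basis consisting of elements conjugate to $\mathbb X\mathbb Y$ in $\Gamma$.
   Context: $\Gamma=PSL(2,\mathbb Z)=\langle\mathbb X\mid\mathbb X^3=1\rangle*\langle\mathbb Y\mid\mathbb Y^2=1\rangle$, where $\mathbb X,\mathbb Y$ are the images of $\begin{pmatrix}-1&1\\-1&0\end{pmatrix}$, $\begin{pmatrix}0&-1\\1&0\end{pmatrix}$. $[\![\mathbb X\mathbb Y]\!]_\Gamma$ is the conjugacy class of $\mathbb X\mathbb Y$ in $\Gamma$. A generalized $(3,1)$-skeleton is a triple $(\mathcal E,\mathrm{op},\mathrm{nx})$, where $\mathcal E$ is a (possibly infinite) set and $\mathrm{op},\mathrm{nx}$ are permutations of $\mathcal E$ with $\mathrm{op}^2=1$, $\mathrm{nx}^3=1$, such that the left $\Gamma$-action on $\mathcal E$ given by $\mathbb X\mapsto\mathrm{nx}^{-1}$, $\mathbb Y\mapsto\mathrm{op}$ is transitive. An isomorphism is a bijection commuting with $\mathrm{op}$ and $\mathrm{nx}$. The set of cosets $\Gamma/H$ with the left $\Gamma$-action is regarded as a generalized $(3,1)$-skeleton. A connected ribbon graph with all vertices trivalent is regarded as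 such a triple: $\mathcal E$ is its set of edge ends, $\mathrm{op}$ assigns to an end the other end of the same edge, and $\mathrm{nx}$ assigns to an end the next end at the same vertex with respect to the cyclic order. An admissible tree is a tree $\Xi\subset S^2$ embedded in the oriented sphere all of whose vertices have valency $3$ (nodes) or $1$ (leaves). Let $\ell$ be a function from the set of leaves of $\Xi$ to $\{0,\vartriangle\}$ such that no two leaves $v_1,v_2$ with $\ell(v_1)=\ell(v_2)=\vartriangle$ are adjacent to the same node. The skeleton $\mathrm{Sk}_{(\Xi,\ell)}$ is the (possibly infinite) trivalent ribbon graph obtained from $\Xi$ by attaching a small loop at each leaf $v$ with $\ell(v)=0$ (so that $v$ becomes trivalent) and by replacing each leaf $v$ with $\ell(v)=\vartriangle$ by the bivalent vertex of an infinite planar tree that has exactly one bivalent vertex and all other vertices trivalent (a "half" of the Farey tree), so that $v$ becomes trivalent too. The skeletons $\mathrm{Sk}_{(\Xi,\ell)}$ with $\ell$ taking values in $\{0,\vartriangle\}$ are called generalized pseudo-trees without monovalent vertices. *)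

theory Defs
  imports
    "HOL-Analysis.Determinants"
    "HOL-Algebra.Generated_Groups"
    "HOL-Algebra.Group_Action"
    "HOL-Algebra.Left_Coset"
begin

section \<open>The modular group\<close>

definition SL2Z :: "(int^2^2) monoid" where
  "SL2Z = \<lparr>carrier = {A. det A = 1}, mult = (**), one = mat 1\<rparr>"

definition PSL2Z :: "(int^2^2) set monoid" where
  "PSL2Z = SL2Z Mod {mat 1, - mat 1}"

definition to_PSL2Z :: "int^2^2 \<Rightarrow> (int^2^2) set" where
  "to_PSL2Z A = {mat 1, - mat 1} #>\<^bsub>SL2Z\<^esub> A"

definition genX :: "(int^2^2) set" where
  "genX = to_PSL2Z (vector [vector [-1, 1], vector [-1, 0]])"

definition genY :: "(int^2^2) set" where
  "genY = to_PSL2Z (vector [vector [0, -1], vector [1, 0]])"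


section \<open>Group-theoretic notions\<close>

definition conjugacy_class :: "('a, 'b) monoid_scheme \<Rightarrow> 'a \<Rightarrow> 'a set" where
  "conjugacy_class G x = {g \<otimes>\<^bsub>G\<^esub> x \<otimes>\<^bsub>G\<^esub> inv\<^bsub>G\<^esub> g | g. g \<in> carrier G}"

definition finitely_generated_subgroup :: "('a, 'b) monoid_scheme \<Rightarrow> 'a set \<Rightarrow> bool" where
  "finitely_generated_subgroup G H \<longleftrightarrow>
     subgroup H G \<and> (\<exists>S. finite S \<and> S \<subseteq> carrier G \<and> generate G S = H)"

text \<open>In a word, the letter \<open>(True, x)\<close> stands for \<open>x\<close> and \<open>(False, x)\<close> for the inverse of \<open>x\<close>.\<close>

definition reduced_word :: "(bool \<times> 'a) list \<Rightarrow> bool" where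
  "reduced_word w \<longleftrightarrow> successively (\<lambda>(s, x) (t, y). \<not> (x = y \<and> s \<noteq> t)) w"

definition word_value :: "('a, 'b) monoid_scheme \<Rightarrow> (bool \<times> 'a) list \<Rightarrow> 'a" where
  "word_value G w =
     foldr (\<lambda>(s, x) y. (if s then x else inv\<^bsub>G\<^esub> x) \<otimes>\<^bsub>G\<^esub> y) w \<one>\<^bsub>G\<^esub>"

text \<open>Every element of \<open>H\<close> is the value of exactly one reduced word in \<open>B\<close>; words of length one
  give \<open>B \<subseteq> H\<close>.\<close>

definition free_basis :: "('a, 'b) monoid_scheme \<Rightarrow> 'a set \<Rightarrow> 'a set \<Rightarrow> bool" where
  "free_basis G H B \<longleftrightarrow>
     bij_betw (word_value G) {w \<in> lists (UNIV \<times> B). reduced_word w} H"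


section \<open>Ribbon graphs and generalized skeletons\<close>

text \<open>
  The same triples represent ribbon graphs and skeletons. The elements of \<open>ends\<close> are the edge
  ends, \<open>opp\<close> exchanges the two ends of an edge, and \<open>nxt\<close> is the cyclic order at the vertices,
  which are the orbits of \<open>nxt\<close>. The values of \<open>opp\<close> and \<open>nxt\<close> outside \<open>ends\<close> are irrelevant.
\<close>

record 'e ribbon =
  ends :: "'e set"
  opp :: "'e \<Rightarrow> 'e"
  nxt :: "'e \<Rightarrow> 'e"

definition generalized_skeleton :: "'e ribbon \<Rightarrow> bool" where
  "generalized_skeleton S \<longleftrightarrow>
     ends S \<noteq> {} \<and>
     bij_betw (opp S) (ends S) (ends S) \<and> bij_betw (nxt S) (ends S) (ends S) \<and>
     (\<forall>e\<in>ends S. opp S (opp S e) = e) \<and>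
     (\<forall>e\<in>ends S. nxt S (nxt S (nxt S e)) = e) \<and>
     (\<exists>\<phi>. transitive_action PSL2Z (ends S) \<phi> \<and>
          (\<forall>e\<in>ends S. \<phi> genX (nxt S e) = e \<and> \<phi> genY e = opp S e))"

definition ribbon_iso :: "'e ribbon \<Rightarrow> 'f ribbon \<Rightarrow> bool" where
  "ribbon_iso S T \<longleftrightarrow>
     (\<exists>f. bij_betw f (ends S) (ends T) \<and>
          (\<forall>e\<in>ends S. f (opp S e) = opp T (f e) \<and> f (nxt S e) = nxt T (f e)))"

definition coset_skeleton :: "(int^2^2) set set \<Rightarrow> (int^2^2) set set ribbon" where
  "coset_skeleton H =
     \<lparr>ends = lcosets\<^bsub>PSL2Z\<^esub> H,
      opp = (\<lambda>C. genY <#\<^bsub>PSL2Z\<^esub> C),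
      nxt = (\<lambda>C. (inv\<^bsub>PSL2Z\<^esub> genX) <#\<^bsub>PSL2Z\<^esub> C)\<rparr>"

definition vertex_at :: "'e ribbon \<Rightarrow> 'e \<Rightarrow> 'e set" where
  "vertex_at G e = {(nxt G ^^ k) e | k. True}"

definition ribbon_graph :: "'e ribbon \<Rightarrow> bool" where
  "ribbon_graph G \<longleftrightarrow>
     bij_betw (opp G) (ends G) (ends G) \<and> bij_betw (nxt G) (ends G) (ends G) \<and>
     (\<forall>e\<in>ends G. opp G e \<noteq> e \<and> opp G (opp G e) = e \<and> finite (vertex_at G e))"

definition connected_ribbon :: "'e ribbon \<Rightarrow> bool" where
  "connected_ribbon G \<longleftrightarrow>
     (\<forall>e\<in>ends G. \<forall>f\<in>ends G.
        (e, f) \<in> ({(x, opp G x) | x. x \<in> ends G} \<union> {(x, nxt G x) | x. x \<in> ends G})\<^sup>*)"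

text \<open>
  A cycle is listed by the ends at which its edges leave the successive vertices. The vertices are
  distinct, and so are the edges: the last condition excludes running back and forth along a
  single edge, while loops and pairs of parallel edges do count as cycles.
\<close>

definition ribbon_cycle :: "'e ribbon \<Rightarrow> 'e list \<Rightarrow> bool" where
  "ribbon_cycle G es \<longleftrightarrow>
     es \<noteq> [] \<and> set es \<subseteq> ends G \<and>
     (\<forall>i<length es. vertex_at G (opp G (es ! i)) = vertex_at G (es ! (Suc i mod length es))) \<and>
     distinct (map (vertex_at G) es) \<and>
     (\<forall>e\<in>set es. opp G e \<notin> set es)"


section \<open>Admissible trees and generalized pseudo-trees\<close>

text \<open>
  A finite tree embedded in the oriented sphere is given, up to orientation-preserving
  homeomorphism of the sphere, by the cyclic orders of the edge ends at its vertices, and every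
  choice of cyclic orders on a finite tree is realized by an embedding.
\<close>

definition admissible_tree :: "'e ribbon \<Rightarrow> bool" where
  "admissible_tree \<Xi> \<longleftrightarrow>
     ribbon_graph \<Xi> \<and> finite (ends \<Xi>) \<and> ends \<Xi> \<noteq> {} \<and>
     connected_ribbon \<Xi> \<and> (\<nexists>es. ribbon_cycle \<Xi> es) \<and>
     (\<forall>e\<in>ends \<Xi>. card (vertex_at \<Xi> e) = 1 \<or> card (vertex_at \<Xi> e) = 3)"

text \<open>A leaf is represented by the unique edge end at it.\<close>

definition leaves :: "'e ribbon \<Rightarrow> 'e set" where
  "leaves \<Xi> = {v \<in> ends \<Xi>. card (vertex_at \<Xi> v) = 1}"

datatype leaf_label = Zero | Tri

text \<open>
  If the vertices adjacent to two distinct leaves coincide, then this common vertex carries at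
  least two edge ends and hence is a node.
\<close>

definition admissible_labelling :: "'e ribbon \<Rightarrow> ('e \<Rightarrow> leaf_label) \<Rightarrow> bool" where
  "admissible_labelling \<Xi> l \<longleftrightarrow>
     (\<forall>v\<in>leaves \<Xi>. \<forall>w\<in>leaves \<Xi>. v \<noteq> w \<and> l v = Tri \<and> l w = Tri \<longrightarrow>
        vertex_at \<Xi> (opp \<Xi> v) \<noteq> vertex_at \<Xi> (opp \<Xi> w))"

text \<open>
  The ends of the skeleton of \<open>(\<Xi>, l)\<close>: those of \<open>\<Xi>\<close>; the two ends of the loop at each leaf
  labelled \<open>Zero\<close>; and, for each leaf \<open>v\<close> labelled \<open>Tri\<close>, the ends of an infinite binary tree
  whose vertices are the lists \<open>p\<close> of booleans. Its root \<open>[]\<close> is bivalent before being glued to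
  \<open>v\<close>. The edge from \<open>p\<close> to its child \<open>b # p\<close> has the end \<open>Down v p b\<close> at \<open>p\<close> and the end
  \<open>Up v p b\<close> at \<open>b # p\<close>.
\<close>

datatype 'e sk_end =
    TreeEnd 'e
  | LoopEnd 'e bool
  | Down 'e "bool list" bool
  | Up 'e "bool list" bool

fun sk_opp :: "'e ribbon \<Rightarrow> 'e sk_end \<Rightarrow> 'e sk_end" where
  "sk_opp \<Xi> (TreeEnd e) = TreeEnd (opp \<Xi> e)"
| "sk_opp \<Xi> (LoopEnd v b) = LoopEnd v (\<not> b)"
| "sk_opp \<Xi> (Down v p b) = Up v p b"
| "sk_opp \<Xi> (Up v p b) = Down v p b"

fun sk_nxt :: "'e ribbon \<Rightarrow> ('e \<Rightarrow> leaf_label) \<Rightarrow> 'e sk_end \<Rightarrow> 'e sk_end" where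
  "sk_nxt \<Xi> l (TreeEnd e) =
     (if e \<in> leaves \<Xi>
      then (case l e of Zero \<Rightarrow> LoopEnd e False | Tri \<Rightarrow> Down e [] False)
      else TreeEnd (nxt \<Xi> e))"
| "sk_nxt \<Xi> l (LoopEnd v False) = LoopEnd v True"
| "sk_nxt \<Xi> l (LoopEnd v True) = TreeEnd v"
| "sk_nxt \<Xi> l (Down v p False) = Down v p True"
| "sk_nxt \<Xi> l (Down v [] True) = TreeEnd v"
| "sk_nxt \<Xi> l (Down v (b # p) True) = Up v p b"
| "sk_nxt \<Xi> l (Up v p b) = Down v (b # p) False"

definition Sk :: "'e ribbon \<Rightarrow> ('e \<Rightarrow> leaf_label) \<Rightarrow> 'e sk_end ribbon" where
  "Sk \<Xi> l =
     \<lparr>ends = TreeEnd ` ends \<Xi> \<union>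
        {LoopEnd v b | v b. v \<in> leaves \<Xi> \<and> l v = Zero} \<union>
        {Down v p b | v p b. v \<in> leaves \<Xi> \<and> l v = Tri} \<union>
        {Up v p b | v p b. v \<in> leaves \<Xi> \<and> l v = Tri},
      opp = sk_opp \<Xi>,
      nxt = sk_nxt \<Xi> l\<rparr>"

text \<open>
  These are the generalized pseudo-trees without monovalent vertices. Since \<open>\<Xi>\<close> is finite,
  taking its ends to be natural numbers is no restriction up to isomorphism.
\<close>

definition generalized_pseudo_tree :: "'e ribbon \<Rightarrow> bool" where
  "generalized_pseudo_tree S \<longleftrightarrow>
     generalized_skeleton S \<and>
     (\<exists>(\<Xi> :: nat ribbon) l.
        admissible_tree \<Xi> \<and> admissible_labelling \<Xi> l \<and> ribbon_iso S (Sk \<Xi> l))"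

end

theory Submission
  imports Defs
begin

text \<open>
  The edge ends of the skeleton of \<open>H\<close> are the cosets \<open>g H\<close>. The conjugate \<open>g\<^sup>-\<^sup>1 X Y g\<close> lies in \<open>H\<close>
  exactly when \<open>X Y g H = g H\<close>, that is, when the other end of the edge at \<open>g H\<close> is the next end at
  the same vertex: the edge is a small loop. So \<open>H\<close> is generated by conjugates of \<open>X Y\<close> if and only
  if its skeleton has no topology other than its small loops: the skeleton becomes a tree when the
  loops are cut.

  To say this inside the group, let \<open>cut_tree\<close> consist of the elements reached from the identity by
  steps \<open>g \<mapsto> X\<^sup>-\<^sup>1 g\<close> and, at ends \<open>g H\<close> that do not belong to a loop, \<open>g \<mapsto> Y g\<close>. They are the walks
  from the base coset in the cut skeleton, taken up to homotopy, and the cut skeleton is a tree if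
  and only if such a walk is determined by its endpoint (\<open>loops_cut_to_tree\<close>). All parts of the
  theorem pass through this condition.

  \<^item> If the loops generate \<open>H\<close>, a covering of the skeleton to which all loops lift as loops is
    trivial (\<open>loops_lift_imp_stabilizer\<close>). Applied to the universal covering of the cut skeleton,
    with the cut loops closed up again, this gives \<open>loops_cut_to_tree\<close>.

  \<^item> If the condition holds, every element of \<open>H\<close> is rewritten along the tree into loop elements
    \<open>g\<^sup>-\<^sup>1 X Y g\<close>, one for each loop. They are free because the group acts on pairs of a group element
    and a reduced word in such a way that passing a loop multiplies the word by the letter of that
    loop (\<open>loop_word_action\<close>).

  \<^item> A finite tree can be mapped into the group, edge by edge, compatibly with both permutations,
    and this map extends over the attached loops and infinite branches; hence a
    generalized pseudo-tree satisfies the condition (\<open>pseudo_tree_imp_loops_cut_to_tree\<close>).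

  \<^item> Conversely, if the loops generate \<open>H\<close>, the paths from one chosen loop to all others span a tree,
    and its skeleton covers that of \<open>H\<close>. As loops lift to loops, the covering is an isomorphism. A
    finitely generated free group has only finite bases, so that there are finitely many loops and
    the tree is finite (\<open>generated_imp_pseudo_tree\<close>).

  All these actions are defined by two permutations of orders 2 and 3, which is possible since the
  modular group is the free product of the subgroups generated by \<open>X\<close> and \<open>Y\<close>
  (\<open>PSL2Z_free_product\<close>).
\<close>

section \<open>The free product of cyclic groups of orders 3 and 2\<close>

text \<open>
  The letters \<open>e\<close> of the list are exponents: \<open>False\<close> stands for \<open>x\<close> and \<open>True\<close> for \<open>x\<^sup>2 = x\<^sup>-\<^sup>1\<close>.
\<close>

primrec alternating_word :: "('a, 'b) monoid_scheme \<Rightarrow> 'a \<Rightarrow> 'a \<Rightarrow> bool list \<Rightarrow> bool \<Rightarrow> 'a" where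
  "alternating_word G x y [] b = (if b then y else \<one>\<^bsub>G\<^esub>)"
| "alternating_word G x y (e # es) b =
     y \<otimes>\<^bsub>G\<^esub> ((if e then x \<otimes>\<^bsub>G\<^esub> x else x) \<otimes>\<^bsub>G\<^esub> alternating_word G x y es b)"

definition normal_form ::
    "('a, 'b) monoid_scheme \<Rightarrow> 'a \<Rightarrow> 'a \<Rightarrow> bool option \<Rightarrow> bool list \<Rightarrow> bool \<Rightarrow> 'a" where
  "normal_form G x y h es b =
     (case h of None \<Rightarrow> alternating_word G x y es b
      | Some e \<Rightarrow> (if e then x \<otimes>\<^bsub>G\<^esub> x else x) \<otimes>\<^bsub>G\<^esub> alternating_word G x y es b)"

text \<open>
  The induction rule says that \<open>X\<close> and \<open>Y\<close> generate the group (inverses are powers), and the last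
  assumption says that a word without cancellations is trivial only if it is empty.
\<close>

locale free_product_3_2 = group G for G (structure) +
  fixes X Y
  assumes X_closed [simp]: "X \<in> carrier G" and Y_closed [simp]: "Y \<in> carrier G"
    and X3: "X \<otimes> (X \<otimes> X) = \<one>" and Y2: "Y \<otimes> Y = \<one>"
    and generator_induct [consumes 1, case_names one X Y]:
      "\<And>P g. g \<in> carrier G \<Longrightarrow> P \<one> \<Longrightarrow> (\<And>g. g \<in> carrier G \<Longrightarrow> P g \<Longrightarrow> P (X \<otimes> g)) \<Longrightarrow>
         (\<And>g. g \<in> carrier G \<Longrightarrow> P g \<Longrightarrow> P (Y \<otimes> g)) \<Longrightarrow> P g"
    and normal_form_unique:
      "normal_form G X Y h es b = \<one> \<Longrightarrow> h = None \<and> es = [] \<and> \<not> b"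

text \<open>
  The graph of the homomorphism that sends \<open>x\<close> to \<open>u\<close> and \<open>y\<close> to \<open>v\<close>, as the submonoid of the product
  generated by \<open>(x, u)\<close> and \<open>(y, v)\<close>. It is total for free, so only its uniqueness needs the
  normal form.
\<close>

inductive corresponds :: "('a, 'b) monoid_scheme \<Rightarrow> 'a \<Rightarrow> 'a \<Rightarrow> ('c, 'd) monoid_scheme \<Rightarrow> 'c \<Rightarrow> 'c \<Rightarrow>
    'a \<Rightarrow> 'c \<Rightarrow> bool" for G x y K u v where
  one: "corresponds G x y K u v \<one>\<^bsub>G\<^esub> \<one>\<^bsub>K\<^esub>"
| X: "corresponds G x y K u v g k \<Longrightarrow> corresponds G x y K u v (x \<otimes>\<^bsub>G\<^esub> g) (u \<otimes>\<^bsub>K\<^esub> k)"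
| Y: "corresponds G x y K u v g k \<Longrightarrow> corresponds G x y K u v (y \<otimes>\<^bsub>G\<^esub> g) (v \<otimes>\<^bsub>K\<^esub> k)"

lemma alternating_word_closed:
  assumes "group G" "x \<in> carrier G" "y \<in> carrier G"
  shows "alternating_word G x y es b \<in> carrier G"
proof -
  interpret group G by fact
  show ?thesis using assms by (induction es) auto
qed

lemma normal_form_X:
  assumes "group G" "x \<in> carrier G" "y \<in> carrier G" "x \<otimes>\<^bsub>G\<^esub> (x \<otimes>\<^bsub>G\<^esub> x) = \<one>\<^bsub>G\<^esub>"
  shows "x \<otimes>\<^bsub>G\<^esub> normal_form G x y h es b =
    normal_form G x y (case h of None \<Rightarrow> Some False | Some False \<Rightarrow> Some True | Some True \<Rightarrow> None) es b"
proof -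
  interpret group G by fact
  have [simp]: "alternating_word G x y es b \<in> carrier G"
    by (rule alternating_word_closed) fact+
  have "x \<otimes>\<^bsub>G\<^esub> (x \<otimes>\<^bsub>G\<^esub> (x \<otimes>\<^bsub>G\<^esub> w)) = w" if "w \<in> carrier G" for w
    using that assms by (metis m_assoc m_closed l_one)
  then show ?thesis
    using assms(2,3) by (auto simp: normal_form_def m_assoc split: option.split bool.split)
qed

lemma normal_form_Y:
  assumes "group G" "x \<in> carrier G" "y \<in> carrier G" "y \<otimes>\<^bsub>G\<^esub> y = \<one>\<^bsub>G\<^esub>"
  shows "y \<otimes>\<^bsub>G\<^esub> normal_form G x y h es b =
    (case h of Some e \<Rightarrow> normal_form G x y None (e # es) b
     | None \<Rightarrow> (case es of [] \<Rightarrow> normal_form G x y None [] (\<not> b)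
                | e # es' \<Rightarrow> normal_form G x y (Some e) es' b))"
proof -
  interpret group G by fact
  have [simp]: "alternating_word G x y es b \<in> carrier G" for es
    by (rule alternating_word_closed) fact+
  have "y \<otimes>\<^bsub>G\<^esub> (y \<otimes>\<^bsub>G\<^esub> w) = w" if "w \<in> carrier G" for w
    using that assms by (metis m_assoc l_one)
  then show ?thesis
    using assms(2-) by (auto simp: normal_form_def split: option.split list.split)
qed

context free_product_3_2
begin

lemma inv_Y [simp]: "inv Y = Y"
  by (simp add: Y2 inv_equality)

lemma inv_X: "inv X = X \<otimes> X"
  by (simp add: X3 inv_equality m_assoc)

context
  fixes K :: "('c, 'd) monoid_scheme" and u v
  assumes K: "group K" and u: "u \<in> carrier K" and v: "v \<in> carrier K"
    and u3: "u \<otimes>\<^bsub>K\<^esub> (u \<otimes>\<^bsub>K\<^esub> u) = \<one>\<^bsub>K\<^esub>" and v2: "v \<otimes>\<^bsub>K\<^esub> v = \<one>\<^bsub>K\<^esub>"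
begin

interpretation K: group K by (rule K)

lemma corresponds_closed: "corresponds G X Y K u v g k \<Longrightarrow> g \<in> carrier G \<and> k \<in> carrier K"
  by (induction rule: corresponds.induct) (auto simp: u v)

lemma corresponds_total: "g \<in> carrier G \<Longrightarrow> \<exists>k. corresponds G X Y K u v g k"
  by (induction g rule: generator_induct) (blast intro: corresponds.intros)+

lemma corresponds_mult:
  assumes "corresponds G X Y K u v g k" and h: "corresponds G X Y K u v h l"
  shows "corresponds G X Y K u v (g \<otimes> h) (k \<otimes>\<^bsub>K\<^esub> l)"
  using assms(1)
proof (induction rule: corresponds.induct)
  case one
  then show ?case using h corresponds_closed[OF h] by simp
next
  case (X g k)
  then show ?case using corresponds.X[OF X.IH] corresponds_closed[OF h] corresponds_closed[OF X.hyps]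
    by (simp add: m_assoc K.m_assoc u)
next
  case (Y g k)
  then show ?case using corresponds.Y[OF Y.IH] corresponds_closed[OF h] corresponds_closed[OF Y.hyps]
    by (simp add: m_assoc K.m_assoc v)
qed

text \<open>
  Rewriting into normal form uses only the relations of orders 3 and 2, which hold in both groups;
  so it can be carried out in both at the same time.
\<close>

lemma corresponds_normal_form:
  assumes "corresponds G X Y K u v g k"
  shows "\<exists>h es b. g = normal_form G X Y h es b \<and> k = normal_form K u v h es b"
  using assms
proof (induction rule: corresponds.induct)
  case one
  then show ?case by (intro exI[of _ None] exI[of _ "[]"] exI[of _ False]) (simp add: normal_form_def)
next
  case (X g k)
  then show ?case
    using normal_form_X[OF group_axioms X_closed Y_closed X3] normal_form_X[OF K u v u3] by metis
next
  case (Y g k)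
  then obtain h es b where *: "g = normal_form G X Y h es b" "k = normal_form K u v h es b" by blast
  show ?case
    unfolding * normal_form_Y[OF group_axioms X_closed Y_closed Y2] normal_form_Y[OF K u v v2]
    by (cases h; cases es) auto
qed

text \<open>
  Multiplying by a partner of the inverse reduces uniqueness to the partners of the identity,
  and the normal form of the identity is empty in both groups.
\<close>

lemma corresponds_unique:
  assumes k: "corresponds G X Y K u v g k" and k': "corresponds G X Y K u v g k'"
  shows "k = k'"
proof -
  have one: "l = \<one>\<^bsub>K\<^esub>" if "corresponds G X Y K u v \<one> l" for l
    using corresponds_normal_form[OF that] normal_form_unique
    by (fastforce simp: normal_form_def)
  have g: "g \<in> carrier G" using corresponds_closed[OF k] by simp
  then obtain l where l: "corresponds G X Y K u v (inv g) l" using corresponds_total by blast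
  have "l \<otimes>\<^bsub>K\<^esub> k = \<one>\<^bsub>K\<^esub>" "l \<otimes>\<^bsub>K\<^esub> k' = \<one>\<^bsub>K\<^esub>"
    using one corresponds_mult[OF l k] corresponds_mult[OF l k'] g by (metis l_inv)+
  then show ?thesis
    using corresponds_closed[OF k] corresponds_closed[OF k'] corresponds_closed[OF l] by (metis K.inv_equality K.inv_inv)
qed

theorem universal_property: "\<exists>\<phi> \<in> hom G K. \<phi> X = u \<and> \<phi> Y = v"
proof -
  obtain \<phi> where \<phi>: "corresponds G X Y K u v g (\<phi> g)" if "g \<in> carrier G" for g
    using corresponds_total by metis
  have "\<phi> \<in> hom G K"
    using corresponds_mult[OF \<phi> \<phi>] corresponds_closed[OF \<phi>] corresponds_unique[OF \<phi>]
    by (auto simp: hom_def)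
  moreover have "\<phi> X = u" "\<phi> Y = v"
    using corresponds.X[OF corresponds.one, of G X Y K u v] corresponds.Y[OF corresponds.one, of G X Y K u v]
      corresponds_unique[OF \<phi>] by (auto simp: u v)
  ultimately show ?thesis by blast
qed

end

text \<open>
  The action of \<open>X\<close> is the inverse of \<open>nx\<close>, which is the convention for skeletons.
\<close>

proposition action_from_permutations:
  assumes op: "\<And>s. s \<in> S \<Longrightarrow> op s \<in> S" "\<And>s. s \<in> S \<Longrightarrow> op (op s) = s"
    and nx: "\<And>s. s \<in> S \<Longrightarrow> nx s \<in> S" "\<And>s. s \<in> S \<Longrightarrow> nx (nx (nx s)) = s"
  obtains \<phi> where "group_action G S \<phi>"
    and "\<And>s. s \<in> S \<Longrightarrow> \<phi> (inv X) s = nx s" and "\<And>s. s \<in> S \<Longrightarrow> \<phi> Y s = op s"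
proof -
  \<comment> \<open>\<open>X\<close> acts as the inverse of \<open>nx\<close>, which is its square.\<close>
  define u v where "u = restrict (\<lambda>s. nx (nx s)) S" and "v = restrict op S"
  have "bij_betw (\<lambda>s. nx (nx s)) S S"
    by (rule bij_betwI[where g = nx]) (use nx in auto)
  moreover have "bij_betw op S S"
    by (rule bij_betwI[where g = op]) (use op in auto)
  ultimately have uv: "u \<in> Bij S" "v \<in> Bij S"
    by (auto simp: u_def v_def Bij_def bij_betw_restrict_eq)
  have "u \<otimes>\<^bsub>BijGroup S\<^esub> (u \<otimes>\<^bsub>BijGroup S\<^esub> u) = \<one>\<^bsub>BijGroup S\<^esub>"
    using uv nx by (auto simp: BijGroup_def compose_Bij) (auto simp: compose_def u_def fun_eq_iff)
  moreover have "v \<otimes>\<^bsub>BijGroup S\<^esub> v = \<one>\<^bsub>BijGroup S\<^esub>"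
    using uv op by (auto simp: BijGroup_def) (auto simp: compose_def v_def fun_eq_iff)
  ultimately obtain \<phi> where \<phi>: "\<phi> \<in> hom G (BijGroup S)" "\<phi> X = u" "\<phi> Y = v"
    using universal_property[OF group_BijGroup, of u S v] uv by (auto simp: BijGroup_def)
  then have act: "group_action G S \<phi>"
    by (intro group_action.intro group_hom.intro group_hom_axioms.intro group_axioms group_BijGroup)
  have "\<phi> (inv X) s = nx s" if "s \<in> S" for s
    using group_action.composition_rule[OF act that X_closed X_closed] that nx by (simp add: inv_X \<phi> u_def)
  moreover have "\<phi> Y s = op s" if "s \<in> S" for s
    using that by (simp add: \<phi> v_def)
  ultimately show thesis using that act by blast
qed

end

section \<open>The modular group\<close>

abbreviation mat2 :: "int \<Rightarrow> int \<Rightarrow> int \<Rightarrow> int \<Rightarrow> int^2^2" where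
  "mat2 a b c d \<equiv> vector [vector [a, b], vector [c, d]]"

lemma mat2_cases: obtains a b c d where "A = mat2 a b c d"
proof
  show "A = mat2 (A$1$1) (A$1$2) (A$2$1) (A$2$2)"
    by (simp add: vec_eq_iff forall_2)
qed

lemma mat2_eq_iff: "mat2 a b c d = mat2 a' b' c' d' \<longleftrightarrow> a = a' \<and> b = b' \<and> c = c' \<and> d = d'"
  by (auto simp: vec_eq_iff forall_2)

lemma mat2_mult: "mat2 a b c d ** mat2 a' b' c' d' =
    mat2 (a * a' + b * c') (a * b' + b * d') (c * a' + d * c') (c * b' + d * d')"
  by (simp add: vec_eq_iff forall_2 matrix_matrix_mult_def sum_2)

lemma det_mat2: "det (mat2 a b c d) = a * d - b * c"
  by (simp add: det_2)

lemma mat_1_eq_mat2: "mat 1 = mat2 1 0 0 1"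
  by (simp add: vec_eq_iff forall_2 mat_def)

lemma uminus_mat2: "- mat2 a b c d = mat2 (- a) (- b) (- c) (- d)"
  by (simp add: vec_eq_iff forall_2)

lemma mat2_mem_SL2Z: "mat2 a b c d \<in> carrier SL2Z \<longleftrightarrow> a * d - b * c = 1"
  by (simp add: SL2Z_def det_mat2)

lemma group_SL2Z: "group SL2Z"
proof (rule groupI)
  fix A assume A: "A \<in> carrier SL2Z"
  obtain a b c d where Aeq: "A = mat2 a b c d" by (rule mat2_cases)
  have "mat2 d (- b) (- c) a \<in> carrier SL2Z" "mat2 d (- b) (- c) a \<otimes>\<^bsub>SL2Z\<^esub> A = \<one>\<^bsub>SL2Z\<^esub>"
    using A unfolding Aeq mat2_mem_SL2Z
    by (auto simp: SL2Z_def mat2_mult mat_1_eq_mat2 mat2_eq_iff algebra_simps)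
  then show "\<exists>B\<in>carrier SL2Z. B \<otimes>\<^bsub>SL2Z\<^esub> A = \<one>\<^bsub>SL2Z\<^esub>" by blast
qed (auto simp: SL2Z_def det_mul matrix_mul_assoc)

lemma minus_mat2_mult: "(- A) ** B = - (A ** B)" "A ** (- B) = - (A ** B)" for A B :: "int^2^2"
  by (cases A rule: mat2_cases; cases B rule: mat2_cases; simp add: mat2_mult uminus_mat2)+

lemma uminus_mem_SL2Z: "A \<in> carrier SL2Z \<Longrightarrow> - A \<in> carrier SL2Z"
  by (cases A rule: mat2_cases) (simp add: uminus_mat2 mat2_mem_SL2Z)

lemma to_PSL2Z_eq: "to_PSL2Z A = {A, - A}"
  by (auto simp: to_PSL2Z_def r_coset_def SL2Z_def minus_mat2_mult)

text \<open>
  The two matrices form the centre, so conjugation fixes each of them.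
\<close>

lemma normal_center: "{mat 1, - mat 1} \<lhd> SL2Z"
proof -
  interpret group SL2Z by (rule group_SL2Z)
  have one: "\<one>\<^bsub>SL2Z\<^esub> = mat 1" by (simp add: SL2Z_def)
  have minv: "inv\<^bsub>SL2Z\<^esub> (- mat 1) = - mat 1"
    using uminus_mem_SL2Z[OF one_closed] unfolding one
    by (intro inv_equality) (auto simp: SL2Z_def minus_mat2_mult)
  have sub: "subgroup {mat 1, - mat 1} SL2Z"
  proof (rule subgroupI)
    show "{mat 1, - mat 1} \<subseteq> carrier SL2Z" using uminus_mem_SL2Z one_closed unfolding one by blast
    show "inv\<^bsub>SL2Z\<^esub> a \<in> {mat 1, - mat 1}" if "a \<in> {mat 1, - mat 1}" for a
      using that minv inv_one unfolding one by auto
  qed (auto simp: SL2Z_def minus_mat2_mult)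
  show ?thesis
    unfolding normal_inv_iff
  proof (intro conjI ballI sub)
    fix A n :: "int^2^2" assume A: "A \<in> carrier SL2Z" and n: "n \<in> {mat 1, - mat 1}"
    have "A \<otimes>\<^bsub>SL2Z\<^esub> n = n \<otimes>\<^bsub>SL2Z\<^esub> A" using n by (auto simp: SL2Z_def minus_mat2_mult)
    then have "A \<otimes>\<^bsub>SL2Z\<^esub> n \<otimes>\<^bsub>SL2Z\<^esub> inv\<^bsub>SL2Z\<^esub> A = n"
      using A n subgroup.subset[OF sub] by (auto simp: m_assoc)
    then show "A \<otimes>\<^bsub>SL2Z\<^esub> n \<otimes>\<^bsub>SL2Z\<^esub> inv\<^bsub>SL2Z\<^esub> A \<in> {mat 1, - mat 1}" using n by simp
  qed
qed

lemma group_PSL2Z: "group PSL2Z"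
  unfolding PSL2Z_def by (rule normal.factorgroup_is_group[OF normal_center])

lemma carrier_PSL2Z: "carrier PSL2Z = to_PSL2Z ` carrier SL2Z"
  by (auto simp: PSL2Z_def FactGroup_def RCOSETS_def to_PSL2Z_def)

lemma to_PSL2Z_mult:
  assumes "A \<in> carrier SL2Z" "B \<in> carrier SL2Z"
  shows "to_PSL2Z A \<otimes>\<^bsub>PSL2Z\<^esub> to_PSL2Z B = to_PSL2Z (A ** B)"
  using normal.rcos_sum[OF normal_center assms] by (simp add: PSL2Z_def to_PSL2Z_def SL2Z_def)

lemma to_PSL2Z_eq_iff: "to_PSL2Z A = to_PSL2Z B \<longleftrightarrow> A = B \<or> A = - B"
  by (auto simp: to_PSL2Z_eq doubleton_eq_iff)

lemma one_PSL2Z: "\<one>\<^bsub>PSL2Z\<^esub> = to_PSL2Z (mat 1)"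
  by (simp add: PSL2Z_def to_PSL2Z_eq)

lemmas mat2_PSL2Z_simps = to_PSL2Z_mult mat2_mem_SL2Z mat2_mult to_PSL2Z_eq_iff uminus_mat2 mat2_eq_iff
  mat_1_eq_mat2 one_PSL2Z

lemma genX_closed: "genX \<in> carrier PSL2Z" and genY_closed: "genY \<in> carrier PSL2Z"
  unfolding genX_def genY_def carrier_PSL2Z
  by (auto simp: mat2_mem_SL2Z)

lemma genX_mult: "a * d - b * c = 1 \<Longrightarrow> genX \<otimes>\<^bsub>PSL2Z\<^esub> to_PSL2Z (mat2 a b c d) =
    to_PSL2Z (mat2 (c - a) (d - b) (- a) (- b))"
  by (simp add: genX_def mat2_PSL2Z_simps)

lemma genX_genX_mult: "a * d - b * c = 1 \<Longrightarrow>
    (genX \<otimes>\<^bsub>PSL2Z\<^esub> genX) \<otimes>\<^bsub>PSL2Z\<^esub> to_PSL2Z (mat2 a b c d) =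
    to_PSL2Z (mat2 (- c) (- d) (a - c) (b - d))"
  by (simp add: genX_def mat2_PSL2Z_simps)

lemma genY_mult: "a * d - b * c = 1 \<Longrightarrow> genY \<otimes>\<^bsub>PSL2Z\<^esub> to_PSL2Z (mat2 a b c d) =
    to_PSL2Z (mat2 (- c) (- d) a b)"
  by (simp add: genY_def mat2_PSL2Z_simps)

context
  fixes P :: "(int^2^2) set \<Rightarrow> bool"
  assumes one: "P \<one>\<^bsub>PSL2Z\<^esub>"
    and X: "\<And>g. g \<in> carrier PSL2Z \<Longrightarrow> P g \<Longrightarrow> P (genX \<otimes>\<^bsub>PSL2Z\<^esub> g)"
    and Y: "\<And>g. g \<in> carrier PSL2Z \<Longrightarrow> P g \<Longrightarrow> P (genY \<otimes>\<^bsub>PSL2Z\<^esub> g)"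
begin

lemma PSL2Z_induct_X:
  assumes "a * d - b * c = 1" "P (to_PSL2Z (mat2 a b c d))"
  shows "P (to_PSL2Z (mat2 (c - a) (d - b) (- a) (- b)))"
  using X[OF _ assms(2)] assms(1) genX_mult[OF assms(1)] by (auto simp: carrier_PSL2Z mat2_mem_SL2Z)

lemma PSL2Z_induct_Y:
  assumes "a * d - b * c = 1" "P (to_PSL2Z (mat2 a b c d))"
  shows "P (to_PSL2Z (mat2 (- c) (- d) a b))"
  using Y[OF _ assms(2)] assms(1) genY_mult[OF assms(1)] by (auto simp: carrier_PSL2Z mat2_mem_SL2Z)

text \<open>
  The matrix of \<open>X Y\<close> is the elementary shear, so left multiplication by its powers adds multiples
  of the second row to the first; \<open>Y\<close> exchanges the rows up to sign.
\<close>

lemma PSL2Z_induct_shear: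
  fixes k :: int
  assumes "a * d - b * c = 1" "P (to_PSL2Z (mat2 a b c d))"
  shows "P (to_PSL2Z (mat2 (a + k * c) (b + k * d) c d))"
proof (induction k rule: int_induct[where k = 0])
  case base
  then show ?case using assms by simp
next
  case (step1 i)
  from PSL2Z_induct_X[OF _ PSL2Z_induct_Y[OF _ step1.IH]] assms(1)
  show ?case by (simp add: algebra_simps)
next
  case (step2 i)
  from PSL2Z_induct_Y[OF _ PSL2Z_induct_X[OF _ PSL2Z_induct_X[OF _ step2.IH]]] assms(1)
  have "P (to_PSL2Z (- mat2 (a + (i - 1) * c) (b + (i - 1) * d) c d))"
    by (simp add: algebra_simps uminus_mat2)
  then show ?case by (simp add: to_PSL2Z_eq insert_commute)
qed

text \<open>
  The Euclidean algorithm on the first column.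
\<close>

lemma PSL2Z_induct_mat2: "a * d - b * c = 1 \<Longrightarrow> P (to_PSL2Z (mat2 a b c d))"
proof (induction "nat \<bar>c\<bar>" arbitrary: a b c d rule: less_induct)
  case less
  show ?case
  proof (cases "c = 0")
    case True
    then consider "a = 1" "d = 1" | "a = -1" "d = -1"
      using less.prems by (auto simp: zmult_eq_1_iff)
    then have *: "to_PSL2Z (mat2 a b c d) = to_PSL2Z (mat2 1 (b * d) 0 1)"
      by cases (auto simp: to_PSL2Z_eq_iff uminus_mat2 mat2_eq_iff True)
    show ?thesis
      unfolding * using PSL2Z_induct_shear[of 1 1 0 0 "b * d"] one
      by (simp add: one_PSL2Z mat_1_eq_mat2)
  next
    case False
    define q where "q = a div c"
    have "nat \<bar>a - q * c\<bar> < nat \<bar>c\<bar>"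
      using False abs_mod_less[of c a] by (simp add: q_def minus_div_mult_eq_mod)
    moreover have det: "(- c) * (b - q * d) - (- d) * (a - q * c) = 1"
      using less.prems by (simp add: algebra_simps)
    ultimately have "P (to_PSL2Z (mat2 (- c) (- d) (a - q * c) (b - q * d)))"
      using less.hyps by blast
    from PSL2Z_induct_Y[OF det this] PSL2Z_induct_shear[of "a - q * c" d "b - q * d" c q] less.prems
    have "P (to_PSL2Z (- mat2 (a - q * c) (b - q * d) c d)) \<and> ?thesis \<or>
        P (to_PSL2Z (- mat2 (a - q * c) (b - q * d) c d)) \<and> \<not> P (to_PSL2Z (mat2 (a - q * c) (b - q * d) c d))"
      by (auto simp: uminus_mat2 algebra_simps)
    then show ?thesis by (simp add: to_PSL2Z_eq insert_commute)
  qed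
qed

end

lemma PSL2Z_generator_induct:
  assumes "g \<in> carrier PSL2Z" "P \<one>\<^bsub>PSL2Z\<^esub>"
    and "\<And>g. g \<in> carrier PSL2Z \<Longrightarrow> P g \<Longrightarrow> P (genX \<otimes>\<^bsub>PSL2Z\<^esub> g)"
    and "\<And>g. g \<in> carrier PSL2Z \<Longrightarrow> P g \<Longrightarrow> P (genY \<otimes>\<^bsub>PSL2Z\<^esub> g)"
  shows "P g"
proof -
  obtain A where "A \<in> carrier SL2Z" "g = to_PSL2Z A" using assms(1) by (auto simp: carrier_PSL2Z)
  then show ?thesis
    using PSL2Z_induct_mat2[of P, OF assms(2-4)]
    by (cases A rule: mat2_cases) (auto simp: mat2_mem_SL2Z)
qed

text \<open>
  Up to sign \<open>Y X\<close> is the matrix with rows \<open>(1, 0)\<close>, \<open>(-1, 1)\<close> and \<open>Y X\<^sup>2\<close> the one with rows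
  \<open>(1, -1)\<close>, \<open>(0, 1)\<close>. Multiplication by these keeps the sign pattern and never decreases the
  absolute values of the entries, so that no cancellation can lead back to the identity.
\<close>

lemma alternating_word_PSL2Z:
  "\<exists>p q r s. alternating_word PSL2Z genX genY es False = to_PSL2Z (mat2 p (- q) (- r) s) \<and>
     p * s - q * r = 1 \<and> p \<ge> 1 \<and> s \<ge> 1 \<and> q \<ge> 0 \<and> r \<ge> 0 \<and> (es \<noteq> [] \<longrightarrow> q + r \<ge> 1)"
proof (induction es)
  case Nil
  show ?case
    by (rule exI[of _ 1], rule exI[of _ 0], rule exI[of _ 0], rule exI[of _ 1])
      (simp add: one_PSL2Z mat_1_eq_mat2)
next
  case (Cons e es)
  then obtain p q r s where *: "alternating_word PSL2Z genX genY es False = to_PSL2Z (mat2 p (- q) (- r) s)"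
     "p * s - q * r = 1" "p \<ge> 1" "s \<ge> 1" "q \<ge> 0" "r \<ge> 0" by blast
  have det: "p * s - (- q) * (- r) = 1" using *(2) by simp
  show ?case
  proof (cases e)
    case True
    have "alternating_word PSL2Z genX genY (e # es) False = to_PSL2Z (mat2 (p + r) (- (q + s)) (- r) s)"
      using True det
      by (simp add: *(1) genX_genX_mult genY_mult to_PSL2Z_eq_iff uminus_mat2 mat2_eq_iff algebra_simps)
    moreover have "(p + r) * s - (q + s) * r = 1" using *(2) by (simp add: algebra_simps)
    ultimately show ?thesis using *(3-)
      by - (rule exI[of _ "p + r"], rule exI[of _ "q + s"], rule exI[of _ r], rule exI[of _ s], simp)
  next
    case False
    have "alternating_word PSL2Z genX genY (e # es) False = to_PSL2Z (mat2 p (- q) (- (p + r)) (q + s))"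
      using False det
      by (simp add: *(1) genX_mult genY_mult to_PSL2Z_eq_iff uminus_mat2 mat2_eq_iff algebra_simps)
    moreover have "p * (q + s) - q * (p + r) = 1" using *(2) by (simp add: algebra_simps)
    ultimately show ?thesis using *(3-)
      by - (rule exI[of _ p], rule exI[of _ q], rule exI[of _ "p + r"], rule exI[of _ "q + s"], simp)
  qed
qed

text \<open>
  The prefix and the suffix of a normal form contribute one of six matrices. Unless both are
  empty, an entry that would have to vanish is, up to sign, a sum of non-negative numbers at least
  one of which is positive.
\<close>

theorem PSL2Z_free_product: "free_product_3_2 PSL2Z genX genY"
proof -
  interpret group PSL2Z by (rule group_PSL2Z)
  show ?thesis
  proof
    show "genX \<otimes>\<^bsub>PSL2Z\<^esub> (genX \<otimes>\<^bsub>PSL2Z\<^esub> genX) = \<one>\<^bsub>PSL2Z\<^esub>"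
      "genY \<otimes>\<^bsub>PSL2Z\<^esub> genY = \<one>\<^bsub>PSL2Z\<^esub>"
      by (simp_all add: genX_def genY_def mat2_PSL2Z_simps)
  next
    fix P g assume "g \<in> carrier PSL2Z" "P \<one>\<^bsub>PSL2Z\<^esub>"
      "\<And>g. g \<in> carrier PSL2Z \<Longrightarrow> P g \<Longrightarrow> P (genX \<otimes>\<^bsub>PSL2Z\<^esub> g)"
      "\<And>g. g \<in> carrier PSL2Z \<Longrightarrow> P g \<Longrightarrow> P (genY \<otimes>\<^bsub>PSL2Z\<^esub> g)"
    then show "P g" by (rule PSL2Z_generator_induct)
  next
    fix h es b
    assume trivial: "normal_form PSL2Z genX genY h es b = \<one>\<^bsub>PSL2Z\<^esub>"
    have trailing_Y: "alternating_word PSL2Z genX genY es True =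
        alternating_word PSL2Z genX genY es False \<otimes>\<^bsub>PSL2Z\<^esub> genY" for es
      by (induction es)
        (auto simp: m_assoc genX_closed genY_closed alternating_word_closed[OF group_PSL2Z])
    obtain p q r s where *:
        "alternating_word PSL2Z genX genY es False = to_PSL2Z (mat2 p (- q) (- r) s)"
        "p * s - q * r = 1" "p \<ge> 1" "s \<ge> 1" "q \<ge> 0" "r \<ge> 0" "es \<noteq> [] \<longrightarrow> q + r \<ge> 1"
      using alternating_word_PSL2Z[of es] by blast
    have det: "p * s - (- q) * (- r) = 1" "(- q) * r - (- p) * s = 1"
      using *(2) by (simp_all add: algebra_simps)
    have w: "alternating_word PSL2Z genX genY es b =
        to_PSL2Z (if b then mat2 (- q) (- p) s r else mat2 p (- q) (- r) s)"
    proof (cases b)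
      case True
      have "alternating_word PSL2Z genX genY es True = to_PSL2Z (mat2 (- q) (- p) s r)"
        unfolding trailing_Y *(1) using det by (simp add: genY_def mat2_PSL2Z_simps)
      with True show ?thesis by simp
    qed (simp add: *(1))
    have X_cases: "normal_form PSL2Z genX genY h es b = to_PSL2Z (
        case h of
          None \<Rightarrow> if b then mat2 (- q) (- p) s r else mat2 p (- q) (- r) s
        | Some False \<Rightarrow> if b then mat2 (s + q) (r + p) q p else mat2 (- r - p) (s + q) (- p) q
        | Some True \<Rightarrow> if b then mat2 (- s) (- r) (- q - s) (- p - r)
            else mat2 r (- s) (p + r) (- q - s))"
      unfolding normal_form_def w using genX_mult[OF det(1)] genX_mult[OF det(2)]
        genX_genX_mult[OF det(1)] genX_genX_mult[OF det(2)]
      by (simp split: option.split bool.split)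
    show "h = None \<and> es = [] \<and> \<not> b"
      using trivial *(3-) unfolding X_cases one_PSL2Z to_PSL2Z_eq_iff mat_1_eq_mat2 uminus_mat2
      by (cases h; cases "the h"; cases b) (simp_all add: mat2_eq_iff; linarith?)+
  qed (rule genX_closed genY_closed)+
qed

section \<open>Reduced words\<close>

text \<open>
  The action of a letter on the set of reduced words, which realizes the free group as a group of
  permutations.
\<close>

definition push :: "bool \<times> 'a \<Rightarrow> (bool \<times> 'a) list \<Rightarrow> (bool \<times> 'a) list" where
  "push l w = (case w of [] \<Rightarrow> [l] | m # w' \<Rightarrow> if snd m = snd l \<and> fst m \<noteq> fst l then w' else l # w)"

lemma reduced_word_Nil [simp]: "reduced_word []"
  by (simp add: reduced_word_def)

lemma reduced_word_single [simp]: "reduced_word [l]"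
  by (simp add: reduced_word_def)

lemma reduced_word_Cons_Cons: "reduced_word (l # m # w) \<longleftrightarrow>
    \<not> (snd m = snd l \<and> fst m \<noteq> fst l) \<and> reduced_word (m # w)"
  by (auto simp: reduced_word_def split: prod.split)

lemma reduced_word_ConsD: "reduced_word (l # w) \<Longrightarrow> reduced_word w"
  by (cases w) (auto simp: reduced_word_Cons_Cons)

lemma reduced_word_push: "reduced_word w \<Longrightarrow> reduced_word (push l w)"
  by (cases w) (auto simp: push_def reduced_word_Cons_Cons dest: reduced_word_ConsD)

lemma push_reduced: "reduced_word (l # w) \<Longrightarrow> push l w = l # w"
  by (cases w) (auto simp: push_def reduced_word_Cons_Cons)

lemma push_cancel: "reduced_word w \<Longrightarrow> push (\<not> s, x) (push (s, x) w) = w"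
proof (cases w)
  case (Cons m w')
  assume "reduced_word w"
  then show ?thesis
    using Cons by (cases w'; cases m) (auto simp: push_def reduced_word_Cons_Cons)
qed (simp add: push_def)

lemma reduced_word_mapD: "reduced_word (map (apsnd f) w) \<Longrightarrow> reduced_word w"
proof (induction w)
  case (Cons l w)
  then show ?case by (cases w) (auto simp: reduced_word_Cons_Cons dest: reduced_word_ConsD)
qed simp

context group
begin

lemma word_value_Nil [simp]: "word_value G [] = \<one>"
  by (simp add: word_value_def)

lemma word_value_Cons [simp]:
  "word_value G ((s, x) # w) = (if s then x else inv x) \<otimes> word_value G w"
  by (simp add: word_value_def)

lemma word_value_closed:
  "B \<subseteq> carrier G \<Longrightarrow> w \<in> lists (UNIV \<times> B) \<Longrightarrow> word_value G w \<in> carrier G"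
  by (induction w) auto

lemma word_value_push:
  assumes "B \<subseteq> carrier G" "w \<in> lists (UNIV \<times> B)" "x \<in> B"
  shows "word_value G (push (s, x) w) = (if s then x else inv x) \<otimes> word_value G w"
proof (cases w)
  case (Cons m w')
  moreover have "word_value G w' \<in> carrier G"
    using assms Cons word_value_closed by auto
  ultimately show ?thesis
    using assms by (cases m) (auto simp: push_def simp flip: m_assoc)
qed (simp add: push_def)

lemma push_lists: "w \<in> lists (UNIV \<times> B) \<Longrightarrow> x \<in> B \<Longrightarrow> push (s, x) w \<in> lists (UNIV \<times> B)"
  by (cases w) (auto simp: push_def)

lemma word_value_in_generate:
  "w \<in> lists (UNIV \<times> B) \<Longrightarrow> word_value G w \<in> generate G B"
proof (induction w)
  case (Cons l w)
  then show ?case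
    by (cases l) (auto intro: generate.intros)
qed (simp add: generate.one)

text \<open>
  The set of values of reduced words is stable under left multiplication by letters,
  because \<open>push\<close> computes such a product.
\<close>

lemma generate_eq_reduced_word_values:
  assumes B: "B \<subseteq> carrier G"
  shows "generate G B = word_value G ` {w \<in> lists (UNIV \<times> B). reduced_word w}"
proof
  have "\<exists>w'\<in>lists (UNIV \<times> B). reduced_word w' \<and> word_value G w' = h \<otimes> word_value G w"
    if "h \<in> generate G B" "w \<in> lists (UNIV \<times> B)" "reduced_word w" for h w
    using that
  proof (induction arbitrary: w rule: generate.induct)
    case one
    then show ?case using word_value_closed[OF B] by auto
  next
    case (incl h)
    then show ?case
      using word_value_push[OF B, of w h True] push_lists[of w B h True] reduced_word_push[of w]
      by (metis (full_types))
  next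
    case (inv h)
    then show ?case
      using word_value_push[OF B, of w h False] push_lists[of w B h False] reduced_word_push[of w]
      by (metis (full_types))
  next
    case (eng h1 h2)
    then show ?case
      using generate_in_carrier[OF B] word_value_closed[OF B] by (metis m_assoc)
  qed
  from this[of _ "[]"] show "generate G B \<subseteq> word_value G ` {w \<in> lists (UNIV \<times> B). reduced_word w}"
    using generate_in_carrier[OF B] by (force simp: image_iff)
qed (auto intro: word_value_in_generate)

lemma free_basis_generates:
  assumes "B \<subseteq> carrier G" "free_basis G H B"
  shows "generate G B = H"
  using assms by (simp add: generate_eq_reduced_word_values free_basis_def bij_betw_def)

text \<open>
  Finitely many generators involve only a finite part \<open>B0\<close> of the basis. A basis element outside
  of \<open>B0\<close> would be the value of a reduced word in \<open>B0\<close> and also of the word of length one.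
\<close>

proposition finite_free_basis:
  assumes B: "B \<subseteq> carrier G" and free: "free_basis G H B"
    and S: "finite S" "generate G S = H"
  shows "finite B"
proof -
  have inj: "inj_on (word_value G) {w \<in> lists (UNIV \<times> B). reduced_word w}"
    using free by (simp add: free_basis_def bij_betw_def)
  have "\<exists>w\<in>lists (UNIV \<times> B). word_value G w = s" if "s \<in> S" for s
  proof -
    have "s \<in> word_value G ` {w \<in> lists (UNIV \<times> B). reduced_word w}"
      using that S(2) generate.incl[of s S G] free by (simp add: free_basis_def bij_betw_def)
    then show ?thesis by auto
  qed
  then obtain w where w: "\<And>s. s \<in> S \<Longrightarrow> w s \<in> lists (UNIV \<times> B)"
      "\<And>s. s \<in> S \<Longrightarrow> word_value G (w s) = s" by metis
  define B0 where "B0 = (\<Union>s\<in>S. snd ` set (w s))"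
  have B0: "finite B0" "B0 \<subseteq> B" using S(1) w(1) by (fastforce simp: B0_def in_lists_conv_set)+
  have "S \<subseteq> generate G B0"
  proof
    fix s assume s: "s \<in> S"
    then have "w s \<in> lists (UNIV \<times> B0)" by (force simp: B0_def)
    then show "s \<in> generate G B0" using word_value_in_generate w(2)[OF s] by fastforce
  qed
  then have H: "H \<subseteq> generate G B0"
    using S(2) generate_subgroup_incl[OF _ generate_is_subgroup] B B0 by blast
  have "B \<subseteq> B0"
  proof
    fix b assume b: "b \<in> B"
    then have "b \<in> generate G B0"
      using H free_basis_generates[OF B free] generate.incl[of b B G] by blast
    then obtain v where v: "v \<in> lists (UNIV \<times> B0)" "reduced_word v" "word_value G v = b"
      using generate_eq_reduced_word_values[of B0] B B0 by auto
    have "v = [(True, b)]"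
      by (rule inj_onD[OF inj]) (use v b B B0 in \<open>auto intro: subsetD[OF lists_mono]\<close>)
    then show "b \<in> B0" using v by simp
  qed
  then show ?thesis using B0 finite_subset by blast
qed

end

section \<open>Loops in the skeleton of a subgroup\<close>

text \<open>
  For \<open>H\<close> equal to the whole group, the only vertex is monovalent and the edge end is fixed by both
  permutations; this degenerate loop has to be excluded.
\<close>

locale free_product_subgroup = free_product_3_2 +
  fixes H
  assumes H: "subgroup H G" and proper: "H \<noteq> carrier G"
begin

interpretation H: subgroup H G by (rule H)

lemma coset_eq_iff:
  assumes "g \<in> carrier G" "k \<in> carrier G"
  shows "g <# H = k <# H \<longleftrightarrow> inv g \<otimes> k \<in> H"
  by (metis H H.lcos_module_imp H.lcos_module_rev assms group_axioms l_repr_independence lcos_self)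

lemma coset_mult_cong:
  assumes "g <# H = k <# H" "g \<in> carrier G" "k \<in> carrier G" "a \<in> carrier G"
  shows "(a \<otimes> g) <# H = (a \<otimes> k) <# H"
  using assms lcos_m_assoc[OF H.subset] by metis

lemma X_inv_X [simp]: "g \<in> carrier G \<Longrightarrow> X \<otimes> (inv X \<otimes> g) = g"
  by (simp flip: m_assoc)

lemma inv_X_X [simp]: "g \<in> carrier G \<Longrightarrow> inv X \<otimes> (X \<otimes> g) = g"
  by (simp flip: m_assoc)

lemma inv_X_inv_X [simp]: "g \<in> carrier G \<Longrightarrow> inv X \<otimes> (inv X \<otimes> g) = X \<otimes> g"
  by (metis X3 X_closed X_inv_X inv_X inv_closed inv_equality m_assoc m_closed l_one)

lemma Y_Y [simp]: "g \<in> carrier G \<Longrightarrow> Y \<otimes> (Y \<otimes> g) = g"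
  by (simp add: Y2 flip: m_assoc)

text \<open>
  At the coset \<open>g H\<close> the condition reads \<open>op e = nx e\<close>: the loop leaves its vertex at \<open>e\<close> and comes
  back at the next end. The other end of the same loop is \<open>Y g H\<close>, so that an end belongs to a loop
  if \<open>loop_end\<close> holds for \<open>g\<close> or for \<open>Y \<otimes> g\<close>.
\<close>

definition loop_end where
  "loop_end g \<longleftrightarrow> (Y \<otimes> g) <# H = (inv X \<otimes> g) <# H"

lemma loop_end_cong:
  assumes "g <# H = k <# H" "g \<in> carrier G" "k \<in> carrier G"
  shows "loop_end g \<longleftrightarrow> loop_end k"
  using coset_mult_cong[OF assms, of Y] coset_mult_cong[OF assms, of "inv X"]
  by (simp add: loop_end_def)

text \<open>
  Otherwise \<open>nx\<^sup>2 e = e\<close>, so \<open>e\<close> is fixed by \<open>nx\<close>, hence by \<open>op\<close>, hence by the whole group.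
\<close>

lemma not_loop_end_both:
  assumes g: "g \<in> carrier G" and "loop_end g" "loop_end (Y \<otimes> g)"
  shows False
proof -
  have Yg: "(Y \<otimes> g) <# H = (inv X \<otimes> g) <# H" and "g <# H = (inv X \<otimes> (Y \<otimes> g)) <# H"
    using assms by (auto simp: loop_end_def)
  then have Xg: "(X \<otimes> g) <# H = g <# H"
    using coset_mult_cong[OF Yg, of "inv X"] g by simp
  then have "(inv X \<otimes> g) <# H = g <# H"
    using coset_mult_cong[OF Xg, of "inv X"] g by simp
  with Yg have Yg: "(Y \<otimes> g) <# H = g <# H" by simp
  have fixed: "(k \<otimes> g) <# H = g <# H" if "k \<in> carrier G" for k
    using that
  proof (induction k rule: generator_induct)
    case (X k)
    then show ?case using coset_mult_cong[OF X.IH, of X] g Xg by (simp add: m_assoc)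
  next
    case (Y k)
    then show ?case using coset_mult_cong[OF Y.IH, of Y] g Yg by (simp add: m_assoc)
  qed (use g in simp)
  have "h \<in> H" if h: "h \<in> carrier G" for h
  proof -
    have "(g \<otimes> h) <# H = g <# H" using fixed[of "g \<otimes> h \<otimes> inv g"] g h by (simp add: m_assoc)
    then have "g <# H = (g \<otimes> h) <# H" by simp
    then show ?thesis using coset_eq_iff[of g "g \<otimes> h"] g h by (simp flip: m_assoc)
  qed
  then show False using proper H.subset by blast
qed

text \<open>
  The group, with left multiplication by \<open>Y\<close> and \<open>X\<^sup>-\<^sup>1\<close>, covers the skeleton by \<open>g \<mapsto> g H\<close>. Here the lifts of the
  loops are cut and glued anew so that each loop lifts to loops; all other edges keep their lift.
\<close>

definition cut_opposite where
  "cut_opposite g = (if loop_end g then inv X \<otimes> g else if loop_end (Y \<otimes> g) then X \<otimes> g else Y \<otimes> g)"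

lemma coset_cut_opposite: "g \<in> carrier G \<Longrightarrow> cut_opposite g <# H = (Y \<otimes> g) <# H"
  using coset_mult_cong[of g "inv X \<otimes> (Y \<otimes> g)" X]
  by (auto simp: cut_opposite_def loop_end_def)

lemma cut_opposite_closed [simp]: "g \<in> carrier G \<Longrightarrow> cut_opposite g \<in> carrier G"
  by (simp add: cut_opposite_def)

lemma loop_end_cut_opposite:
  assumes "g \<in> carrier G"
  shows "loop_end (cut_opposite g) \<longleftrightarrow> loop_end (Y \<otimes> g)"
    and "loop_end (Y \<otimes> cut_opposite g) \<longleftrightarrow> loop_end g"
  using loop_end_cong[OF coset_cut_opposite] loop_end_cong[OF coset_mult_cong[OF coset_cut_opposite, of g Y]]
    assms by auto

lemma cut_opposite_involution [simp]: "g \<in> carrier G \<Longrightarrow> cut_opposite (cut_opposite g) = g"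
  using not_loop_end_both[of g] loop_end_cut_opposite[of g] by (auto simp: cut_opposite_def)

text \<open>
  The homotopy classes of walks from the base coset that pass through no loop. A step along a loop
  can be replaced by a step around its vertex, so these walks still reach every coset.
\<close>

inductive_set cut_tree where
  one: "\<one> \<in> cut_tree"
| X: "g \<in> cut_tree \<Longrightarrow> inv X \<otimes> g \<in> cut_tree"
| Y: "g \<in> cut_tree \<Longrightarrow> \<not> loop_end g \<Longrightarrow> \<not> loop_end (Y \<otimes> g) \<Longrightarrow> Y \<otimes> g \<in> cut_tree"

lemma cut_tree_closed: "g \<in> cut_tree \<Longrightarrow> g \<in> carrier G"
  by (induction rule: cut_tree.induct) auto

text \<open>
  The cut skeleton is simply connected, that is, a tree.
\<close>

definition loops_cut_to_tree where
  "loops_cut_to_tree \<longleftrightarrow> (\<forall>g\<in>cut_tree. \<forall>k\<in>cut_tree. g <# H = k <# H \<longrightarrow> g = k)"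

lemma equivariant_extend:
  assumes act: "group_action G S \<phi>"
    and f: "\<And>s. s \<in> S \<Longrightarrow> f s \<subseteq> carrier G"
    and nx: "\<And>s. s \<in> S \<Longrightarrow> f (\<phi> (inv X) s) = inv X <# f s"
    and op: "\<And>s. s \<in> S \<Longrightarrow> f (\<phi> Y s) = Y <# f s"
    and g: "g \<in> carrier G" and s: "s \<in> S"
  shows "f (\<phi> g s) = g <# f s"
  using g
proof (induction g rule: generator_induct)
  case one
  show ?case using f[OF s] s group_action.id_eq_one[OF act] by (simp add: lcos_mult_one fun_eq_iff)
      (metis restrict_apply' )
next
  case (X g)
  have "\<phi> (X \<otimes> g) s = \<phi> (inv X) (\<phi> (inv X) (\<phi> g s))"
    using X.hyps s by (simp add: group_action.composition_rule[OF act, symmetric] group_action.element_image[OF act])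
  then show ?case
    using X f[OF s] s
    by (simp add: nx group_action.element_image[OF act _ s refl] group_action.element_image[OF act _ _ refl]
        lcos_m_assoc)
next
  case (Y g)
  then show ?case
    using Y f[OF s] s
    by (simp add: op group_action.composition_rule[OF act] group_action.element_image[OF act _ s refl] lcos_m_assoc)
qed

context
  assumes gen: "generate G (H \<inter> conjugacy_class G (X \<otimes> Y)) = H"
begin

text \<open>
  The monodromy of a covering \<open>f\<close> of the skeleton. A conjugate \<open>k X Y k\<^sup>-\<^sup>1\<close> in \<open>H\<close> runs to a loop along
  \<open>k\<^sup>-\<^sup>1\<close>, once around it, and back. If the loop lifts to a loop, the lifted path closes up as well.
  So the generators of \<open>H\<close>, and with them all of \<open>H\<close>, fix the base point of the covering.
\<close>

proposition loops_lift_imp_stabilizer: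
  assumes act: "group_action G S \<phi>" and s0: "s0 \<in> S" "f s0 = H"
    and f: "\<And>s. s \<in> S \<Longrightarrow> f s \<subseteq> carrier G"
    and nx: "\<And>s. s \<in> S \<Longrightarrow> f (\<phi> (inv X) s) = inv X <# f s"
    and op: "\<And>s. s \<in> S \<Longrightarrow> f (\<phi> Y s) = Y <# f s"
    and lift: "\<And>s. s \<in> S \<Longrightarrow> Y <# f s = inv X <# f s \<Longrightarrow> \<phi> Y s = \<phi> (inv X) s"
    and h: "h \<in> H"
  shows "\<phi> h s0 = s0"
proof -
  note comp = group_action.composition_rule[OF act] and mem = group_action.element_image[OF act _ _ refl]
  have id: "\<phi> \<one> s = s" if "s \<in> S" for s
    using group_action.id_eq_one[OF act] that by (metis restrict_apply')
  have loop: "\<phi> h s0 = s0" if hC: "h \<in> H \<inter> conjugacy_class G (X \<otimes> Y)" for h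
  proof -
    obtain k where k: "k \<in> carrier G" "h = k \<otimes> (X \<otimes> Y) \<otimes> inv k" "h \<in> H"
      using hC by (auto simp: conjugacy_class_def)
    define s where "s = \<phi> (inv k) s0"
    have s: "s \<in> S" using k s0 mem by (simp add: s_def)
    have fs: "f s = inv k <# H"
      using equivariant_extend[OF act f nx op _ s0(1), of "inv k"] s0(2) k by (simp add: s_def)
    have "inv (inv k) \<otimes> (X \<otimes> (Y \<otimes> inv k)) \<in> H" using k by (simp add: m_assoc)
    then have "inv k <# H = (X \<otimes> (Y \<otimes> inv k)) <# H"
      using coset_eq_iff[of "inv k" "X \<otimes> (Y \<otimes> inv k)"] k by simp
    then have "(inv X \<otimes> inv k) <# H = (Y \<otimes> inv k) <# H"
      using coset_mult_cong[of "inv k" "X \<otimes> (Y \<otimes> inv k)" "inv X"] k by simp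
    then have "\<phi> Y s = \<phi> (inv X) s"
      using lift[OF s] k by (simp add: fs lcos_m_assoc H.subset)
    then have "\<phi> (X \<otimes> Y) s = \<phi> X (\<phi> (inv X) s)" using comp s by simp
    also have "\<dots> = s" using comp[OF s, of X "inv X"] s id by simp
    finally have "\<phi> (k \<otimes> (X \<otimes> Y)) s = \<phi> k s" using comp s k by simp
    then show "\<phi> h s0 = s0"
      using comp[OF s0(1), of "k \<otimes> (X \<otimes> Y)" "inv k"] comp[OF s0(1), of k "inv k"] k s0 id
      by (simp add: s_def)
  qed
  have "h \<in> generate G (H \<inter> conjugacy_class G (X \<otimes> Y))" using h gen by simp
  then show ?thesis
  proof (induction rule: generate.induct)
    case one
    then show ?case using id s0 by simp
  next
    case (incl h)
    then show ?case by (rule loop)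
  next
    case (inv h)
    then have "h \<in> carrier G" using H.subset by blast
    then show ?case using loop[OF inv] comp[OF s0(1), of "inv h" h] id s0 by simp
  next
    case (eng h1 h2)
    then have "h1 \<in> carrier G" "h2 \<in> carrier G" using gen H.subset by auto
    then show ?case using eng comp s0 by simp
  qed
qed

text \<open>
  In the covering given by \<open>cut_opposite\<close>, an element \<open>g\<close> of the cut tree carries the base point to
  \<open>g\<close> itself, since its walk meets no modified edge. Two elements with the same coset differ by an
  element of \<open>H\<close>, which fixes the base point.
\<close>

theorem generated_imp_loops_cut_to_tree: "loops_cut_to_tree"
proof -
  obtain \<phi> where act: "group_action G (carrier G) \<phi>"
    and nx: "\<And>g. g \<in> carrier G \<Longrightarrow> \<phi> (inv X) g = inv X \<otimes> g"
    and op: "\<And>g. g \<in> carrier G \<Longrightarrow> \<phi> Y g = cut_opposite g"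
    using action_from_permutations[of "carrier G" cut_opposite "\<lambda>g. inv X \<otimes> g"] by auto
  note comp = group_action.composition_rule[OF act]
  have stab: "\<phi> h \<one> = \<one>" if "h \<in> H" for h
  proof (rule loops_lift_imp_stabilizer[OF act, where f = "\<lambda>g. g <# H", OF _ _ _ _ _ _ that])
    show "\<one> <# H = H" using H.subset by (rule lcos_mult_one)
    show "\<phi> Y s = \<phi> (inv X) s"
      if "s \<in> carrier G" "Y <# (s <# H) = inv X <# (s <# H)" for s
      using that by (simp add: nx op cut_opposite_def loop_end_def lcos_m_assoc H.subset)
  qed (auto simp: nx op coset_cut_opposite lcos_m_assoc H.subset l_coset_subset_G)
  have lift: "\<phi> g \<one> = g" if "g \<in> cut_tree" for g
    using that
  proof induction
    case one
    then show ?case using stab[OF H.one_closed] .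
  next
    case (X g)
    then show ?case using comp[of \<one> "inv X" g] nx[of g] cut_tree_closed by simp
  next
    case (Y g)
    then show ?case using comp[of \<one> Y g] op[of g] cut_tree_closed by (simp add: cut_opposite_def)
  qed
  show ?thesis
    unfolding loops_cut_to_tree_def
  proof (intro ballI impI)
    fix g k assume gk: "g \<in> cut_tree" "k \<in> cut_tree" "g <# H = k <# H"
    then have mem: "g \<in> carrier G" "k \<in> carrier G" using cut_tree_closed by auto
    then have h: "inv g \<otimes> k \<in> H" using gk coset_eq_iff by simp
    have "k = \<phi> (g \<otimes> (inv g \<otimes> k)) \<one>"
      using mem lift[OF gk(2)] by (simp flip: m_assoc)
    also have "\<dots> = \<phi> g \<one>" using comp[of \<one> g "inv g \<otimes> k"] mem stab[OF h] by simp
    also have "\<dots> = g" by (rule lift[OF gk(1)])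
    finally show "g = k" by simp
  qed
qed

end

section \<open>The free basis given by the loops\<close>

definition loop_element where
  "loop_element g = inv g \<otimes> (X \<otimes> (Y \<otimes> g))"

definition loop_basis where
  "loop_basis = loop_element ` {g \<in> cut_tree. loop_end g}"

lemma loop_element_closed [simp]: "g \<in> carrier G \<Longrightarrow> loop_element g \<in> carrier G"
  by (simp add: loop_element_def)

lemma loop_element_conjugate: "g \<in> carrier G \<Longrightarrow> loop_element g \<in> conjugacy_class G (X \<otimes> Y)"
  unfolding conjugacy_class_def loop_element_def
  by (rule CollectI, rule exI[of _ "inv g"]) (simp add: m_assoc)

lemma loop_element_mem:
  assumes "g \<in> carrier G" "loop_end g"
  shows "loop_element g \<in> H"
  using assms coset_mult_cong[of "Y \<otimes> g" "inv X \<otimes> g" X] coset_eq_iff[of g "X \<otimes> (Y \<otimes> g)"]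
  by (simp add: loop_end_def loop_element_def)

lemma loop_basis_closed: "loop_basis \<subseteq> carrier G"
  by (auto simp: loop_basis_def cut_tree_closed)

lemma loop_basis_subset: "loop_basis \<subseteq> H \<inter> conjugacy_class G (X \<otimes> Y)"
  by (auto simp: loop_basis_def cut_tree_closed loop_element_mem loop_element_conjugate)

text \<open>
  Following a word letter by letter, the walk stays in the cut tree; whenever a loop has to be passed,
  the loop element or its inverse is split off to the right.
\<close>

lemma cut_tree_transversal:
  assumes "k \<in> carrier G"
  shows "\<exists>g\<in>cut_tree. \<exists>h\<in>generate G loop_basis. k = g \<otimes> h"
  using assms
proof (induction k rule: generator_induct)
  case one
  then show ?case using cut_tree.one generate.one by force
next
  case (X k)
  then obtain g h where gh: "g \<in> cut_tree" "h \<in> generate G loop_basis" "k = g \<otimes> h" by blast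
  then have "inv X \<otimes> (inv X \<otimes> g) \<in> cut_tree" by (intro cut_tree.X)
  then have "X \<otimes> g \<in> cut_tree" using gh cut_tree_closed by simp
  moreover have "X \<otimes> k = (X \<otimes> g) \<otimes> h"
    using gh cut_tree_closed generate_in_carrier[OF loop_basis_closed] by (simp add: m_assoc)
  ultimately show ?case using gh by blast
next
  case (Y k)
  then obtain g h where gh: "g \<in> cut_tree" "h \<in> generate G loop_basis" "k = g \<otimes> h" by blast
  have mem: "g \<in> carrier G" "h \<in> carrier G"
    using gh cut_tree_closed generate_in_carrier[OF loop_basis_closed] by auto
  consider "loop_end g" | "loop_end (Y \<otimes> g)" | "\<not> loop_end g" "\<not> loop_end (Y \<otimes> g)" by blast
  then show ?case
  proof cases
    case 1
    have "Y \<otimes> k = (inv X \<otimes> g) \<otimes> (loop_element g \<otimes> h)"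
      using mem gh by (simp add: loop_element_def m_assoc inv_solve_left' inv_solve_left)
        (simp flip: m_assoc)
    moreover have "loop_element g \<otimes> h \<in> generate G loop_basis"
      using 1 gh by (intro generate.eng[OF generate.incl gh(2)]) (auto simp: loop_basis_def)
    ultimately show ?thesis using gh cut_tree.X by blast
  next
    case 2
    \<comment> \<open>The loop is passed from its second end, which leads back to the first end \<open>X \<otimes> g\<close>.\<close>
    have Xg: "X \<otimes> g \<in> cut_tree"
      using gh mem cut_tree.X[OF cut_tree.X[OF gh(1)]] by simp
    have "loop_end (X \<otimes> g)"
      using 2 mem not_loop_end_both[of g] loop_end_cut_opposite(1)[of g]
      by (cases "loop_end g") (auto simp: cut_opposite_def)
    then have "inv (loop_element (X \<otimes> g)) \<otimes> h \<in> generate G loop_basis"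
      using Xg gh by (intro generate.eng[OF generate.inv gh(2)]) (auto simp: loop_basis_def)
    moreover have "Y \<otimes> k = (X \<otimes> g) \<otimes> (inv (loop_element (X \<otimes> g)) \<otimes> h)"
    proof -
      have "(X \<otimes> g) \<otimes> inv (loop_element (X \<otimes> g)) = Y \<otimes> g"
        using mem by (simp add: loop_element_def inv_mult_group m_assoc) (simp flip: m_assoc)
      then show ?thesis using mem gh by (simp flip: m_assoc)
    qed
    ultimately show ?thesis using Xg by blast
  next
    case 3
    then have "Y \<otimes> g \<in> cut_tree" using gh by (intro cut_tree.Y)
    moreover have "Y \<otimes> k = (Y \<otimes> g) \<otimes> h" using gh mem by (simp add: m_assoc)
    ultimately show ?thesis using gh by blast
  qed
qed

text \<open>
  The cut tree meets \<open>H\<close> in the identity only.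
\<close>

lemma generate_loop_basis:
  assumes loops_cut_to_tree
  shows "generate G loop_basis = H"
proof
  show "generate G loop_basis \<subseteq> H"
    using loop_basis_subset H by (intro generate_subgroup_incl) auto
  show "H \<subseteq> generate G loop_basis"
  proof
    fix h assume h: "h \<in> H"
    then obtain g k where gk: "g \<in> cut_tree" "k \<in> generate G loop_basis" "h = g \<otimes> k"
      using cut_tree_transversal H.subset by blast
    have k: "k \<in> H" using gk \<open>generate G loop_basis \<subseteq> H\<close> by blast
    have mem: "g \<in> carrier G" "k \<in> carrier G" using gk(1) k cut_tree_closed H.subset by auto
    have "g = h \<otimes> inv k" using gk(3) mem by (simp add: m_assoc)
    then have "g \<in> H" using h k by simp
    then have "g <# H = \<one> <# H" using mem coset_eq_iff[of \<one> g] by simp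
    then have "g = \<one>" using assms gk(1) cut_tree.one unfolding loops_cut_to_tree_def by blast
    then show "h \<in> generate G loop_basis" using gk mem by simp
  qed
qed

text \<open>
  The universal covering with its loops glued as in \<open>cut_opposite\<close>, together with a second component
  that records the loops passed so far as an element of the free group on all loop ends.
\<close>

lemma loop_word_action:
  obtains \<phi> where "group_action G (carrier G \<times> {w. reduced_word w}) \<phi>"
    and "\<And>g w. g \<in> cut_tree \<Longrightarrow> loop_end g \<Longrightarrow> reduced_word w \<Longrightarrow>
      \<phi> (loop_element g) (\<one>, w) = (\<one>, push (True, g) w)"
proof -
  define op where "op = (\<lambda>(g, w). (cut_opposite g,
    if loop_end g then push (True, g) w
    else if loop_end (Y \<otimes> g) then push (False, X \<otimes> g) w else w))"
  define nx where "nx = (\<lambda>(g, w :: (bool \<times> 'a) list). (inv X \<otimes> g, w))"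
  let ?S = "carrier G \<times> {w :: (bool \<times> 'a) list. reduced_word w}"
  have op2: "op (op s) = s" if "s \<in> ?S" for s
    using that not_loop_end_both[of "fst s"] loop_end_cut_opposite[of "fst s"]
      push_cancel[of "snd s" True] push_cancel[of "snd s" False]
    by (auto simp: op_def split: prod.split) (auto simp: cut_opposite_def)
  have op_closed: "op s \<in> ?S" if "s \<in> ?S" for s
    using that by (auto simp: op_def reduced_word_push)
  have nx_closed: "nx s \<in> ?S" and nx3: "nx (nx (nx s)) = s" if "s \<in> ?S" for s
    using that by (auto simp: nx_def)
  obtain \<phi> where act: "group_action G ?S \<phi>"
    and nx: "\<And>s. s \<in> ?S \<Longrightarrow> \<phi> (inv X) s = nx s"
    and op: "\<And>s. s \<in> ?S \<Longrightarrow> \<phi> Y s = op s"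
    using action_from_permutations[of ?S op nx, OF op_closed op2 nx_closed nx3] by blast
  note comp = group_action.composition_rule[OF act]
  have id: "\<phi> \<one> s = s" if "s \<in> ?S" for s
    using group_action.id_eq_one[OF act] that by (metis restrict_apply')
  have lift: "\<phi> g (\<one>, w) = (g, w)" if "g \<in> cut_tree" "reduced_word w" for g w
    using that
  proof induction
    case one
    then show ?case using id by simp
  next
    case (X g)
    then show ?case using comp[of "(\<one>, w)" "inv X" g] nx[of "(g, w)"] cut_tree_closed by (simp add: nx_def)
  next
    case (Y g)
    then show ?case using comp[of "(\<one>, w)" Y g] op[of "(g, w)"] cut_tree_closed
      by (simp add: op_def cut_opposite_def)
  qed
  have "\<phi> (loop_element g) (\<one>, w) = (\<one>, push (True, g) w)"
    if g: "g \<in> cut_tree" and loop: "loop_end g" and w: "reduced_word w" for g w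
  proof -
    have mem: "g \<in> carrier G" using g by (rule cut_tree_closed)
    let ?w = "push (True, g) w"
    have w': "reduced_word ?w" using w by (rule reduced_word_push)
    have "\<phi> (Y \<otimes> g) (\<one>, w) = (inv X \<otimes> g, ?w)"
      using comp[of "(\<one>, w)" Y g] op[of "(g, w)"] lift[OF g w] w mem loop
      by (simp add: op_def cut_opposite_def)
    also have "\<dots> = \<phi> (inv X \<otimes> g) (\<one>, ?w)"
      using comp[of "(\<one>, ?w)" "inv X" g] nx[of "(g, ?w)"] lift[OF g w'] w' mem by (simp add: nx_def)
    finally have *: "\<phi> (Y \<otimes> g) (\<one>, w) = \<phi> (inv X \<otimes> g) (\<one>, ?w)" .
    have "\<phi> (loop_element g) (\<one>, w) = \<phi> (inv g \<otimes> X) (\<phi> (Y \<otimes> g) (\<one>, w))"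
      using comp[of "(\<one>, w)" "inv g \<otimes> X" "Y \<otimes> g"] mem w by (simp add: loop_element_def m_assoc)
    also have "\<dots> = \<phi> ((inv g \<otimes> X) \<otimes> (inv X \<otimes> g)) (\<one>, ?w)"
      unfolding * using comp[of "(\<one>, ?w)" "inv g \<otimes> X" "inv X \<otimes> g"] mem w' by simp
    also have "(inv g \<otimes> X) \<otimes> (inv X \<otimes> g) = \<one>" using mem by (simp add: m_assoc)
    finally show ?thesis using id w' by simp
  qed
  with act that show thesis by blast
qed

text \<open>
  The action on the empty word recovers a reduced word from its value.
\<close>

theorem loop_basis_free:
  assumes loops_cut_to_tree
  shows "free_basis G H loop_basis"
proof -
  let ?L = "{g \<in> cut_tree. loop_end g}"
  let ?S = "carrier G \<times> {w :: (bool \<times> 'a) list. reduced_word w}"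
  obtain \<phi> where act: "group_action G ?S \<phi>"
    and loop': "\<And>g w. g \<in> cut_tree \<Longrightarrow> loop_end g \<Longrightarrow> reduced_word w \<Longrightarrow>
      \<phi> (loop_element g) (\<one>, w) = (\<one>, push (True, g) w)"
    by (rule loop_word_action) blast
  have loop: "\<phi> (loop_element g) (\<one>, w) = (\<one>, push (True, g) w)"
    if "g \<in> ?L" "reduced_word w" for g w
    using loop' that by simp
  note comp = group_action.composition_rule[OF act]
  have id: "\<phi> \<one> s = s" if "s \<in> ?S" for s
    using group_action.id_eq_one[OF act] that by (metis restrict_apply')
  have inv_loop: "\<phi> (inv (loop_element g)) (\<one>, w) = (\<one>, push (False, g) w)"
    if g: "g \<in> ?L" and w: "reduced_word w" for g w
  proof -
    have "\<phi> (loop_element g) (\<one>, push (False, g) w) = (\<one>, w)"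
      using loop[OF g reduced_word_push[OF w]] push_cancel[OF w, of False] by simp
    then have "\<phi> (inv (loop_element g)) (\<one>, w) = \<phi> (inv (loop_element g) \<otimes> loop_element g) (\<one>, push (False, g) w)"
      using comp[of "(\<one>, push (False, g) w)" "inv (loop_element g)" "loop_element g"] g w cut_tree_closed
      by (simp add: reduced_word_push del: l_inv)
    then show ?thesis using id g w cut_tree_closed by (simp add: reduced_word_push)
  qed
  have word: "\<phi> (word_value G (map (apsnd loop_element) v)) (\<one>, []) = (\<one>, v)"
    if "v \<in> lists (UNIV \<times> ?L)" "reduced_word v" for v
    using that
  proof (induction v)
    case (Cons l v)
    obtain s g where l: "l = (s, g)" "g \<in> ?L" using Cons.hyps by auto
    have v: "reduced_word v" using Cons.prems reduced_word_ConsD by blast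
    have "map (apsnd loop_element) v \<in> lists (UNIV \<times> loop_basis)"
      using Cons.hyps by (fastforce simp: loop_basis_def)
    then have mem: "g \<in> carrier G" "word_value G (map (apsnd loop_element) v) \<in> carrier G"
      using l word_value_closed[OF loop_basis_closed] cut_tree_closed by auto
    have "\<phi> (word_value G (map (apsnd loop_element) (l # v))) (\<one>, []) =
        \<phi> (if s then loop_element g else inv (loop_element g)) (\<one>, v)"
      using Cons v mem by (simp add: l comp)
    also have "\<dots> = (\<one>, push l v)"
      using loop[OF l(2) v] inv_loop[OF l(2) v] by (simp add: l)
    also have "\<dots> = (\<one>, l # v)" using push_reduced[OF Cons.prems] by simp
    finally show ?case .
  qed (simp add: id)
  have letters: "UNIV \<times> loop_basis = apsnd loop_element ` (UNIV \<times> ?L)"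
    by (auto simp: loop_basis_def image_iff)
  have lift: "\<exists>v\<in>lists (UNIV \<times> ?L). reduced_word v \<and> w = map (apsnd loop_element) v"
    if "w \<in> lists (UNIV \<times> loop_basis)" "reduced_word w" for w
  proof -
    have "w \<in> map (apsnd loop_element) ` lists (UNIV \<times> ?L)"
      using that(1) unfolding letters lists_image .
    then obtain v where v: "w = map (apsnd loop_element) v" "v \<in> lists (UNIV \<times> ?L)"
      by (rule imageE)
    moreover have "reduced_word v" using that(2) unfolding v(1) by (rule reduced_word_mapD)
    ultimately show ?thesis by blast
  qed
  have "inj_on (word_value G) {w \<in> lists (UNIV \<times> loop_basis). reduced_word w}"
  proof (rule inj_onI)
    fix w w' assume w: "w \<in> {w \<in> lists (UNIV \<times> loop_basis). reduced_word w}"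
      and w': "w' \<in> {w \<in> lists (UNIV \<times> loop_basis). reduced_word w}"
      and eq: "word_value G w = word_value G w'"
    obtain v where v: "v \<in> lists (UNIV \<times> ?L)" "reduced_word v" "w = map (apsnd loop_element) v"
      using lift w by blast
    obtain v' where v': "v' \<in> lists (UNIV \<times> ?L)" "reduced_word v'" "w' = map (apsnd loop_element) v'"
      using lift w' by blast
    have "(\<one>, v) = (\<one>, v')" using word[OF v(1,2)] word[OF v'(1,2)] eq unfolding v(3) v'(3) by metis
    then show "w = w'" unfolding v(3) v'(3) by simp
  qed
  then show ?thesis
    using generate_loop_basis[OF assms] generate_eq_reduced_word_values[OF loop_basis_closed]
    by (simp add: free_basis_def bij_betw_def)
qed

end

section \<open>Vertices and paths in ribbon graphs\<close>

lemma vertex_at_refl [simp]: "e \<in> vertex_at G e"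
  unfolding vertex_at_def by (rule CollectI, rule exI[of _ 0]) simp

lemma nxt_mem_vertex_at: "nxt G e \<in> vertex_at G e"
  unfolding vertex_at_def by (rule CollectI, rule exI[of _ 1]) simp

context
  fixes G :: "'e ribbon"
  assumes G: "ribbon_graph G"
begin

lemma opp_closed: "e \<in> ends G \<Longrightarrow> opp G e \<in> ends G"
  and nxt_closed: "e \<in> ends G \<Longrightarrow> nxt G e \<in> ends G"
  and opp_opp: "e \<in> ends G \<Longrightarrow> opp G (opp G e) = e"
  and opp_neq: "e \<in> ends G \<Longrightarrow> opp G e \<noteq> e"
  using G by (auto simp: ribbon_graph_def bij_betw_def)

lemma nxt_pow_closed: "e \<in> ends G \<Longrightarrow> (nxt G ^^ k) e \<in> ends G"
  by (induction k) (auto intro: nxt_closed)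

lemma vertex_at_subset: "e \<in> ends G \<Longrightarrow> vertex_at G e \<subseteq> ends G"
  by (auto simp: vertex_at_def nxt_pow_closed)

lemma nxt_pow_inj:
  "e \<in> ends G \<Longrightarrow> f \<in> ends G \<Longrightarrow> (nxt G ^^ k) e = (nxt G ^^ k) f \<Longrightarrow> e = f"
proof (induction k arbitrary: e f)
  case (Suc k)
  have "(nxt G ^^ k) (nxt G e) = (nxt G ^^ k) (nxt G f)"
    using Suc.prems(3) by (simp only: funpow_Suc_right o_apply)
  then have "nxt G e = nxt G f" using Suc by (blast intro: nxt_closed)
  moreover have "inj_on (nxt G) (ends G)" using G by (auto simp: ribbon_graph_def bij_betw_def)
  ultimately show ?case using Suc.prems by (meson inj_onD)
qed simp

text \<open>
  By finiteness the orbit of \<open>e\<close> is periodic, and the period is its size.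
\<close>

lemma vertex_at_orbit:
  assumes e: "e \<in> ends G"
  shows "(nxt G ^^ card (vertex_at G e)) e = e"
    and "vertex_at G e = (\<lambda>k. (nxt G ^^ k) e) ` {..<card (vertex_at G e)}"
proof -
  let ?f = "\<lambda>k. (nxt G ^^ k) e" and ?c = "card (vertex_at G e)"
  have fin: "finite (vertex_at G e)" using G e by (auto simp: ribbon_graph_def)
  have "card (?f ` {..?c}) \<le> ?c"
    by (rule card_mono[OF fin]) (auto simp: vertex_at_def)
  then have "\<not> inj_on ?f {..?c}" using card_image[of ?f "{..?c}"] by auto
  then obtain i j where ij: "i < j" "j \<le> ?c" "?f i = ?f j"
    unfolding inj_on_def by (metis atMost_iff linorder_neqE_nat)
  have "(nxt G ^^ i) e = (nxt G ^^ i) (?f (j - i))"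
    using ij by (simp flip: funpow_add[THEN fun_cong, unfolded o_apply])
  then have m: "?f (j - i) = e"
    using nxt_pow_inj e nxt_pow_closed by metis
  have sub: "vertex_at G e \<subseteq> ?f ` {..<j - i}"
  proof
    fix x assume "x \<in> vertex_at G e"
    then obtain k where "x = ?f k" by (auto simp: vertex_at_def)
    then have "x = ?f (k mod (j - i))" using funpow_mod_eq[OF m] by simp
    then show "x \<in> ?f ` {..<j - i}" using ij(1) by auto
  qed
  then have "?c \<le> card (?f ` {..<j - i})" by (intro card_mono) auto
  also have "\<dots> \<le> j - i" using card_image_le[of "{..<j - i}" ?f] by simp
  finally have c: "?c = j - i" using ij by simp
  show "(nxt G ^^ ?c) e = e" using m c by simp
  show "vertex_at G e = ?f ` {..<?c}" using sub unfolding c by (auto simp: vertex_at_def)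
qed

lemma vertex_at_eq:
  assumes e: "e \<in> ends G" and f: "f \<in> vertex_at G e"
  shows "vertex_at G f = vertex_at G e"
proof -
  obtain k where k: "f = (nxt G ^^ k) e" using f by (auto simp: vertex_at_def)
  have "(nxt G ^^ i) f \<in> vertex_at G e" for i
    unfolding k vertex_at_def by (rule CollectI, rule exI[of _ "i + k"]) (simp add: funpow_add)
  moreover have "(nxt G ^^ i) e \<in> vertex_at G f" for i
  proof -
    let ?c = "card (vertex_at G e)"
    have "?c > 0" using vertex_at_orbit(2)[OF e] vertex_at_refl[of e G] by (cases ?c) auto
    then have le: "k \<le> i + k * ?c" by (simp add: trans_le_add2)
    have mul: "(nxt G ^^ (m * ?c)) e = e" for m
      by (induction m) (simp_all add: funpow_add vertex_at_orbit(1)[OF e])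
    have "(nxt G ^^ i) e = (nxt G ^^ (i + k * ?c)) e" using mul by (simp add: funpow_add)
    also have "\<dots> = (nxt G ^^ (i + k * ?c - k)) f"
      unfolding k using le by (simp flip: funpow_add[THEN fun_cong, unfolded o_apply])
    finally show ?thesis by (auto simp: vertex_at_def)
  qed
  ultimately show ?thesis unfolding vertex_at_def[of G f] vertex_at_def[of G e] by (auto simp: vertex_at_def)
qed

lemma monovalent_vertex:
  assumes "e \<in> ends G" "card (vertex_at G e) = 1"
  shows "nxt G e = e" "vertex_at G e = {e}"
  using vertex_at_orbit[OF assms(1)] assms(2) by auto

lemma trivalent_vertex:
  assumes "e \<in> ends G" "card (vertex_at G e) = 3"
  shows "nxt G (nxt G (nxt G e)) = e" "vertex_at G e = {e, nxt G e, nxt G (nxt G e)}"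
    "distinct [e, nxt G e, nxt G (nxt G e)]"
proof -
  have *: "vertex_at G e = (\<lambda>k. (nxt G ^^ k) e) ` {..<3}"
    using vertex_at_orbit(2)[OF assms(1)] assms(2) by simp
  also have "{..<3} = {0, 1, 2 :: nat}" by auto
  finally show v: "vertex_at G e = {e, nxt G e, nxt G (nxt G e)}" by (simp add: numeral_2_eq_2)
  show "nxt G (nxt G (nxt G e)) = e"
    using vertex_at_orbit(1)[OF assms(1)] assms(2) by (simp add: numeral_3_eq_3)
  show "distinct [e, nxt G e, nxt G (nxt G e)]"
    using assms(2) unfolding v by (auto simp: card_insert_if split: if_splits)
qed

fun walk :: "'e \<Rightarrow> 'e list \<Rightarrow> 'e \<Rightarrow> bool" where
  "walk a [] b \<longleftrightarrow> vertex_at G a = vertex_at G b"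
| "walk a (e # es) b \<longleftrightarrow> vertex_at G a = vertex_at G e \<and> walk (opp G e) es b"

lemma walk_append_edge: "walk a es b \<Longrightarrow> vertex_at G b = vertex_at G e \<Longrightarrow> walk a (es @ [e]) (opp G e)"
  by (induction es arbitrary: a) auto

lemma walk_cong: "walk a es b \<Longrightarrow> vertex_at G b = vertex_at G c \<Longrightarrow> walk a es c"
  by (induction es arbitrary: a) auto

lemma walk_first: "walk a es b \<Longrightarrow> es \<noteq> [] \<Longrightarrow> vertex_at G (es ! 0) = vertex_at G a"
  by (cases es) auto

lemma walk_nth:
  "walk a es b \<Longrightarrow> i < length es \<Longrightarrow> vertex_at G (opp G (es ! i)) =
    (if Suc i < length es then vertex_at G (es ! Suc i) else vertex_at G b)"
proof (induction es arbitrary: a i)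
  case (Cons e es)
  show ?case
  proof (cases i)
    case 0
    then show ?thesis using Cons.prems walk_first[of "opp G e" es b] by (cases es) auto
  next
    case (Suc j)
    then show ?thesis using Cons.IH[where a = "opp G e" and i = j] Cons.prems by simp
  qed
qed simp

text \<open>
  The cyclic index of a ribbon cycle wraps around at the end of the list, which is where closedness
  of the walk enters.
\<close>

lemma closed_walk_is_cycle:
  assumes walk: "walk a es a" "es \<noteq> []"
    and es: "set es \<subseteq> ends G" "distinct (map (vertex_at G) es)" "\<forall>e\<in>set es. opp G e \<notin> set es"
  shows "ribbon_cycle G es"
proof -
  have "vertex_at G (opp G (es ! i)) = vertex_at G (es ! (Suc i mod length es))" if i: "i < length es" for i
  proof (cases "Suc i < length es")
    case True
    then show ?thesis using walk_nth[OF walk(1) i] by simp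
  next
    case False
    then have "Suc i = length es" using i by simp
    then show ?thesis using walk_nth[OF walk(1) i] walk_first[OF walk] by simp
  qed
  then show ?thesis using walk es by (simp add: ribbon_cycle_def)
qed

definition simple_path where
  "simple_path A a es b \<longleftrightarrow> walk a es b \<and> set es \<subseteq> A \<and> opp G ` set es \<subseteq> A \<and>
     distinct (map (vertex_at G) es) \<and> vertex_at G b \<notin> vertex_at G ` set es \<and>
     (\<forall>x\<in>set es. opp G x \<notin> set es)"

text \<open>
  A set of whole vertices any two of which are joined by a path inside the set without
  repetitions. The final vertex of a path must be new too, so that one more edge can be appended.
\<close>

definition path_connected_part where
  "path_connected_part A \<longleftrightarrow> A \<subseteq> ends G \<and> (\<forall>e\<in>A. vertex_at G e \<subseteq> A) \<and>
     (\<forall>a\<in>A. \<forall>b\<in>A. \<exists>es. simple_path A a es b)"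

lemma path_connected_part_vertex:
  assumes "e \<in> ends G"
  shows "path_connected_part (vertex_at G e)"
  unfolding path_connected_part_def
proof (intro conjI ballI)
  show "\<exists>es. simple_path (vertex_at G e) a es b" if "a \<in> vertex_at G e" "b \<in> vertex_at G e" for a b
    using vertex_at_eq[OF assms that(1)] vertex_at_eq[OF assms that(2)]
    by (intro exI[of _ "[]"]) (simp add: simple_path_def)
  show "vertex_at G e \<subseteq> ends G" by (rule vertex_at_subset[OF assms])
  show "vertex_at G f \<subseteq> vertex_at G e" if "f \<in> vertex_at G e" for f
    using vertex_at_eq[OF assms that] by simp
qed

context
  fixes A e
  assumes acyclic: "\<nexists>es. ribbon_cycle G es"
    and A: "path_connected_part A" and e: "e \<in> A" "opp G e \<notin> A"
begin

lemma new_vertex_facts: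
  shows "e \<in> ends G" "opp G e \<in> ends G" "A \<subseteq> ends G"
    and "a \<in> A \<Longrightarrow> vertex_at G a \<subseteq> A"
    and "vertex_at G (opp G e) \<inter> A = {}"
    and "f \<in> vertex_at G (opp G e) \<Longrightarrow> vertex_at G f = vertex_at G (opp G e)"
    and "a \<in> A \<Longrightarrow> vertex_at G a \<noteq> vertex_at G (opp G e)"
proof -
  show ends: "A \<subseteq> ends G" "e \<in> ends G" "opp G e \<in> ends G"
    using A e(1) opp_closed by (auto simp: path_connected_part_def)
  show closed: "vertex_at G a \<subseteq> A" if "a \<in> A" for a
    using A that by (simp add: path_connected_part_def)
  show v: "vertex_at G f = vertex_at G (opp G e)" if "f \<in> vertex_at G (opp G e)" for f
    by (rule vertex_at_eq[OF ends(3) that])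
  show disj: "vertex_at G (opp G e) \<inter> A = {}"
  proof (rule ccontr)
    assume "vertex_at G (opp G e) \<inter> A \<noteq> {}"
    then obtain f where f: "f \<in> vertex_at G (opp G e)" "f \<in> A" by blast
    then have "opp G e \<in> vertex_at G f" using v[OF f(1)] by simp
    then show False using closed f(2) e(2) by blast
  qed
  show "vertex_at G a \<noteq> vertex_at G (opp G e)" if "a \<in> A" for a
    using disj that vertex_at_refl[of a G] by blast
qed

text \<open>
  A second edge between the new vertex and \<open>A\<close> would close up, with the path in \<open>A\<close> and the edge \<open>e\<close>,
  to a cycle; an edge from the new vertex to itself would be a cycle of length one.
\<close>

lemma only_new_edge:
  assumes f: "f \<in> vertex_at G (opp G e)" and oppf: "opp G f \<in> A \<union> vertex_at G (opp G e)"
  shows "f = opp G e"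
proof (rule ccontr)
  assume neq: "f \<noteq> opp G e"
  note facts = new_vertex_facts
  have f_ends: "f \<in> ends G" using f facts(2) vertex_at_subset by blast
  have vf: "vertex_at G f = vertex_at G (opp G e)" by (rule facts(6)[OF f])
  show False
  proof (cases "opp G f \<in> A")
    case False
    then have "vertex_at G (opp G f) = vertex_at G f" using oppf facts(6) vf by blast
    then have "ribbon_cycle G [f]"
      using f_ends opp_neq[OF f_ends] by (intro closed_walk_is_cycle[of f]) auto
    then show False using acyclic by blast
  next
    case True
    then obtain es where es: "simple_path A (opp G f) es e"
      using A e unfolding path_connected_part_def by blast
    have opp_es: "x \<noteq> opp G f" "x \<noteq> opp G e" if "x \<in> set es" for x
    proof -
      have "opp G x \<in> A" "x \<in> A" using es that by (auto simp: simple_path_def)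
      then show "x \<noteq> opp G f" "x \<noteq> opp G e"
        using opp_opp[OF f_ends] f facts(5) e by auto
    qed
    have walk: "walk (opp G f) ((es @ [e]) @ [f]) (opp G f)"
      using es walk_append_edge[of "opp G f" es e e] walk_append_edge[of _ "es @ [e]" "opp G e" f] vf
      by (auto simp: simple_path_def)
    have "ribbon_cycle G ((es @ [e]) @ [f])"
    proof (rule closed_walk_is_cycle[OF walk])
      have es': "set es \<subseteq> A" "opp G ` set es \<subseteq> A" "distinct (map (vertex_at G) es)"
        "vertex_at G e \<notin> vertex_at G ` set es" "\<forall>x\<in>set es. opp G x \<notin> set es"
        using es by (auto simp: simple_path_def)
      show "distinct (map (vertex_at G) ((es @ [e]) @ [f]))"
      proof -
        have "vertex_at G f \<noteq> vertex_at G x" if "x \<in> set es" for x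
          using facts(7)[of x] es'(1) that unfolding vf by auto
        then have "vertex_at G f \<notin> vertex_at G ` set es" by blast
        moreover have "vertex_at G e \<noteq> vertex_at G f" using facts(7)[OF e(1)] unfolding vf .
        ultimately show ?thesis using es'(3,4) by simp
      qed
      have opp_x: "opp G x \<noteq> e" "opp G x \<noteq> f" if "x \<in> set es" for x
      proof -
        have "opp G (opp G x) = x" using that es'(1) facts(3) opp_opp by blast
        then show "opp G x \<noteq> e" "opp G x \<noteq> f" using opp_es[OF that] by metis+
      qed
      have opp_new: "opp G e \<notin> set es" "opp G f \<notin> set es" using opp_es by blast+
      have "opp G f \<noteq> e" using neq opp_opp[OF f_ends] by metis
      then have "opp G x \<notin> set es \<and> opp G x \<noteq> e \<and> opp G x \<noteq> f" if "x \<in> set es \<or> x = e \<or> x = f" for x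
        using that es'(5) opp_new opp_x[of x] opp_neq[OF facts(1)] opp_neq[OF f_ends] neq by metis
      then show "\<forall>x\<in>set ((es @ [e]) @ [f]). opp G x \<notin> set ((es @ [e]) @ [f])" by simp
      show "set ((es @ [e]) @ [f]) \<subseteq> ends G" using es'(1) facts(1,3) f_ends by auto
    qed simp
    then show False using acyclic by blast
  qed
qed

text \<open>
  Paths from and to the new vertex run through the edge of \<open>e\<close>.
\<close>

lemma path_connected_part_add_vertex: "path_connected_part (A \<union> vertex_at G (opp G e))"
proof -
  note facts = new_vertex_facts
  let ?v = "vertex_at G (opp G e)"
  have paths: "\<exists>es. simple_path A a es b" if "a \<in> A" "b \<in> A" for a b
    using A that by (simp add: path_connected_part_def)
  have mono: "simple_path (A \<union> ?v) a es b" if "simple_path A a es b" for a es b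
    using that by (auto simp: simple_path_def)
  have new_notin: "vertex_at G (opp G e) \<notin> vertex_at G ` set es" if "set es \<subseteq> A" for es
    using facts(7) that by (metis (no_types, lifting) imageE subsetD)
  have to_new: "\<exists>es. simple_path (A \<union> ?v) a es b" if a: "a \<in> A" and b: "b \<in> ?v" for a b
  proof -
    obtain es where es: "simple_path A a es e" using paths a e by blast
    have "opp G x \<noteq> e" if "x \<in> set es" for x
      using that es facts(3) opp_opp e(2) by (auto simp: simple_path_def) (metis subsetD)
    moreover have "walk a (es @ [e]) b"
      using walk_cong[OF walk_append_edge[of a es e e]] es facts(6)[OF b]
      by (simp add: simple_path_def)
    moreover have "vertex_at G b \<notin> vertex_at G ` set es" "vertex_at G b \<noteq> vertex_at G e"
      using new_notin[of es] facts(7)[OF e(1)] es unfolding facts(6)[OF b] by (auto simp: simple_path_def)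
    ultimately have "simple_path (A \<union> ?v) a (es @ [e]) b"
      using es e opp_neq[OF facts(1)] by (auto simp: simple_path_def)
    then show ?thesis by blast
  qed
  have from_new: "\<exists>es. simple_path (A \<union> ?v) a es b" if a: "a \<in> ?v" and b: "b \<in> A" for a b
  proof -
    obtain es where es: "simple_path A e es b" using paths b e by blast
    have "opp G x \<noteq> opp G e" if "x \<in> set es" for x
      using that es e(2) by (auto simp: simple_path_def)
    moreover have "opp G e \<notin> set es" "vertex_at G (opp G e) \<notin> vertex_at G ` set es"
      "vertex_at G b \<noteq> vertex_at G (opp G e)"
      using new_notin[of es] facts(7)[OF b] es e(2) by (auto simp: simple_path_def)
    ultimately have "simple_path (A \<union> ?v) a (opp G e # es) b"
      using es e facts(6)[OF a] opp_opp[OF facts(1)] opp_neq[OF facts(1)]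
      by (auto simp: simple_path_def)
    then show ?thesis by blast
  qed
  have "\<exists>es. simple_path (A \<union> ?v) a es b" if "a \<in> ?v" "b \<in> ?v" for a b
    using facts(6)[OF that(1)] facts(6)[OF that(2)] by (intro exI[of _ "[]"]) (simp add: simple_path_def)
  then have "\<forall>a\<in>A \<union> ?v. \<forall>b\<in>A \<union> ?v. \<exists>es. simple_path (A \<union> ?v) a es b"
    using paths mono to_new from_new by blast
  then show ?thesis
    using facts(3,4,6) vertex_at_subset[OF facts(2)] unfolding path_connected_part_def by blast
qed

end

end

section \<open>Generalized pseudo-trees are cut to a tree\<close>

context
  fixes \<Xi> :: "'e ribbon" and op nx :: "'z \<Rightarrow> 'z" and Z :: "'z set"
  assumes tree: "admissible_tree \<Xi>"
    and op: "\<And>z. z \<in> Z \<Longrightarrow> op z \<in> Z" "\<And>z. z \<in> Z \<Longrightarrow> op (op z) = z"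
    and nx: "\<And>z. z \<in> Z \<Longrightarrow> nx z \<in> Z" "\<And>z. z \<in> Z \<Longrightarrow> nx (nx (nx z)) = z"
    and Z: "Z \<noteq> {}"
begin

text \<open>
  A map into a set with two permutations that respects the edges inside \<open>A\<close> and the cyclic order at
  the nodes. Nothing is required at the leaves, where the skeleton gets further ends.
\<close>

definition section_on :: "'e set \<Rightarrow> ('e \<Rightarrow> 'z) \<Rightarrow> bool" where
  "section_on A s \<longleftrightarrow> s ` A \<subseteq> Z \<and>
     (\<forall>e\<in>A. opp \<Xi> e \<in> A \<longrightarrow> s (opp \<Xi> e) = op (s e)) \<and>
     (\<forall>e\<in>A - leaves \<Xi>. s (nxt \<Xi> e) = nx (s e))"

lemma ribbon_graph_tree: "ribbon_graph \<Xi>"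
  using tree by (simp add: admissible_tree_def)

text \<open>
  At a trivalent vertex the value at one end forces the other two, consistently because \<open>nx\<close> has
  order 3.
\<close>

lemma vertex_section:
  assumes e: "e \<in> ends \<Xi>" and z: "z \<in> Z"
  obtains s where "s ` vertex_at \<Xi> e \<subseteq> Z" "s e = z"
    "\<And>f. f \<in> vertex_at \<Xi> e - leaves \<Xi> \<Longrightarrow> s (nxt \<Xi> f) = nx (s f)"
proof (cases "card (vertex_at \<Xi> e) = 1")
  case True
  then have "vertex_at \<Xi> e = {e}" "e \<in> leaves \<Xi>"
    using monovalent_vertex[OF ribbon_graph_tree e] e by (auto simp: leaves_def)
  then show thesis using that[of "\<lambda>_. z"] z by auto
next
  case False
  then have "card (vertex_at \<Xi> e) = 3" using tree e by (auto simp: admissible_tree_def)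
  note v = trivalent_vertex[OF ribbon_graph_tree e this]
  define s where "s f = (if f = e then z else if f = nxt \<Xi> e then nx z else nx (nx z))" for f
  have "s (nxt \<Xi> f) = nx (s f)" if "f \<in> vertex_at \<Xi> e" for f
    using that v z nx by (auto simp: s_def)
  then show thesis using that[of s] v z nx by (auto simp: s_def)
qed

text \<open>
  The new vertex is attached to \<open>A\<close> by a single edge, so the only condition linking the two parts
  determines one value at the new vertex.
\<close>

lemma section_extends:
  assumes A: "path_connected_part \<Xi> A" "section_on A s" and e: "e \<in> A" "opp \<Xi> e \<notin> A"
  shows "\<exists>s'. section_on (A \<union> vertex_at \<Xi> (opp \<Xi> e)) s'"
proof -
  let ?v = "vertex_at \<Xi> (opp \<Xi> e)"
  have acyclic: "\<nexists>es. ribbon_cycle \<Xi> es" using tree by (simp add: admissible_tree_def)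
  note facts = new_vertex_facts[OF ribbon_graph_tree acyclic A(1) e]
  note edge = only_new_edge[OF ribbon_graph_tree acyclic A(1) e]
  have se: "s e \<in> Z" using A(2) e by (auto simp: section_on_def)
  obtain t where t: "t ` ?v \<subseteq> Z" "t (opp \<Xi> e) = op (s e)"
    "\<And>f. f \<in> ?v - leaves \<Xi> \<Longrightarrow> t (nxt \<Xi> f) = nx (t f)"
    by (rule vertex_section[OF facts(2) op(1)[OF se]]) blast
  define s' where "s' f = (if f \<in> A then s f else t f)" for f
  have s'_A: "s' f = s f" if "f \<in> A" for f using that by (simp add: s'_def)
  have s'_v: "s' f = t f" if "f \<in> ?v" for f using that facts(5) by (auto simp: s'_def)
  have "section_on (A \<union> ?v) s'"
    unfolding section_on_def
  proof (intro conjI ballI impI)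
    show "s' ` (A \<union> ?v) \<subseteq> Z"
    proof (rule image_subsetI)
      fix f assume "f \<in> A \<union> ?v"
      then show "s' f \<in> Z"
        using A(2) t(1) by (cases "f \<in> A") (auto simp: s'_def section_on_def)
    qed
  next
    fix f assume f: "f \<in> A \<union> ?v" "opp \<Xi> f \<in> A \<union> ?v"
    have f_ends: "f \<in> ends \<Xi>" using f facts(3) vertex_at_subset[OF ribbon_graph_tree facts(2)] by blast
    consider "f \<in> A" "opp \<Xi> f \<in> A" | "f \<in> A" "opp \<Xi> f \<in> ?v" | "f \<in> ?v" using f by blast
    then show "s' (opp \<Xi> f) = op (s' f)"
    proof cases
      case 1
      then have "s (opp \<Xi> f) = op (s f)" using A(2) unfolding section_on_def by blast
      then show ?thesis using 1 by (simp only: s'_A)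
    next
      case 2
      have "opp \<Xi> (opp \<Xi> f) \<in> A" using 2(1) opp_opp[OF ribbon_graph_tree f_ends] by simp
      then have "opp \<Xi> f = opp \<Xi> e" using edge[OF 2(2)] by blast
      then have "f = e"
        using opp_opp[OF ribbon_graph_tree f_ends] opp_opp[OF ribbon_graph_tree facts(1)] by metis
      then show ?thesis using t(2) s'_A[OF e(1)] s'_v[OF vertex_at_refl] by (simp only:)
    next
      case 3
      then have "f = opp \<Xi> e" using edge f(2) by blast
      then have "opp \<Xi> f = e" "s' f = op (s e)"
        using opp_opp[OF ribbon_graph_tree facts(1)] t(2) s'_v[OF vertex_at_refl] by metis+
      then show ?thesis using s'_A[OF e(1)] op(2)[OF se] by (simp only:)
    qed
  next
    fix f assume f: "f \<in> A \<union> ?v - leaves \<Xi>"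
    show "s' (nxt \<Xi> f) = nx (s' f)"
    proof (cases "f \<in> A")
      case True
      then have "nxt \<Xi> f \<in> A" using facts(4)[OF True] nxt_mem_vertex_at[of \<Xi> f] by blast
      moreover have "s (nxt \<Xi> f) = nx (s f)" using True f A(2) by (simp add: section_on_def)
      ultimately show ?thesis using True by (simp only: s'_A)
    next
      case False
      then have fv: "f \<in> ?v" using f by blast
      then have "nxt \<Xi> f \<in> ?v" using facts(6)[OF fv] nxt_mem_vertex_at[of \<Xi> f] by simp
      moreover have "t (nxt \<Xi> f) = nx (t f)" using fv f t(3) by blast
      ultimately show ?thesis using fv by (simp only: s'_v)
    qed
  qed
  then show ?thesis by blast
qed

text \<open>
  A largest connected part with a section is everything: it is closed under \<open>opp\<close> by the extension
  lemma, and the tree is connected.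
\<close>

proposition admissible_tree_section: "\<exists>s. section_on (ends \<Xi>) s"
proof -
  let ?P = "\<lambda>A. path_connected_part \<Xi> A \<and> A \<noteq> {} \<and> (\<exists>s. section_on A s)"
  have fin: "finite (ends \<Xi>)" and "ends \<Xi> \<noteq> {}" and conn: "connected_ribbon \<Xi>"
    and acyclic: "\<nexists>es. ribbon_cycle \<Xi> es"
    using tree by (auto simp: admissible_tree_def)
  then obtain e where e: "e \<in> ends \<Xi>" by blast
  obtain z where z: "z \<in> Z" using Z by blast
  let ?v = "vertex_at \<Xi> e"
  have start: "?P ?v"
  proof (intro conjI)
    show "path_connected_part \<Xi> ?v" by (rule path_connected_part_vertex[OF ribbon_graph_tree e])
    show "?v \<noteq> {}" using vertex_at_refl[of e \<Xi>] by blast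
    obtain s where s: "s ` ?v \<subseteq> Z" "s e = z" "\<And>f. f \<in> ?v - leaves \<Xi> \<Longrightarrow> s (nxt \<Xi> f) = nx (s f)"
      by (rule vertex_section[OF e z]) blast
    have False if "f \<in> ?v" "opp \<Xi> f \<in> ?v" for f
    proof -
      have f: "f \<in> ends \<Xi>" using that(1) vertex_at_subset[OF ribbon_graph_tree e] by blast
      have "ribbon_cycle \<Xi> [f]"
        using vertex_at_eq[OF ribbon_graph_tree e that(1)] vertex_at_eq[OF ribbon_graph_tree e that(2)]
          f opp_neq[OF ribbon_graph_tree f]
        by (intro closed_walk_is_cycle[OF ribbon_graph_tree, of f]) (auto simp: walk.simps[OF ribbon_graph_tree])
      then show False using acyclic by blast
    qed
    then show "\<exists>s. section_on ?v s" using s unfolding section_on_def by blast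
  qed
  \<comment> \<open>needed for a part of largest size to exist\<close>
  have bound: "\<forall>A. ?P A \<longrightarrow> card A \<le> card (ends \<Xi>)"
    using card_mono[OF fin] by (auto simp: path_connected_part_def[OF ribbon_graph_tree])
  then obtain A where A: "?P A" and max: "\<And>B. ?P B \<Longrightarrow> card B \<le> card A"
    using ex_has_greatest_nat[of ?P ?v card "Suc (card (ends \<Xi>))"] start by (auto simp: less_Suc_eq_le)
  have A_ends: "A \<subseteq> ends \<Xi>" and A_closed: "\<And>f. f \<in> A \<Longrightarrow> vertex_at \<Xi> f \<subseteq> A"
    using A by (auto simp: path_connected_part_def[OF ribbon_graph_tree])
  have opp_A: "opp \<Xi> f \<in> A" if f: "f \<in> A" for f
  proof (rule ccontr)
    assume nf: "opp \<Xi> f \<notin> A"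
    let ?B = "A \<union> vertex_at \<Xi> (opp \<Xi> f)"
    have "?P ?B"
      using path_connected_part_add_vertex[OF ribbon_graph_tree acyclic _ f nf] section_extends[OF _ _ f nf] A
      by blast
    then have le: "card ?B \<le> card A" and "?B \<subseteq> ends \<Xi>"
      using max by (auto simp: path_connected_part_def[OF ribbon_graph_tree])
    then have "card A < card ?B"
      using nf vertex_at_refl[of "opp \<Xi> f" \<Xi>] finite_subset[OF _ fin] by (intro psubset_card_mono) blast+
    then show False using le by simp
  qed
  obtain a where a: "a \<in> A" using A by blast
  have "ends \<Xi> \<subseteq> A"
  proof
    fix f assume "f \<in> ends \<Xi>"
    then have "(a, f) \<in> ({(x, opp \<Xi> x) | x. x \<in> ends \<Xi>} \<union> {(x, nxt \<Xi> x) | x. x \<in> ends \<Xi>})\<^sup>*"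
      using conn a A_ends by (auto simp: connected_ribbon_def)
    then show "f \<in> A"
    proof (induction rule: rtrancl_induct)
      case (step f g)
      then show ?case using opp_A A_closed[of f] nxt_mem_vertex_at[of \<Xi> f] by auto
    qed (rule a)
  qed
  then show ?thesis using A A_ends by (metis subset_antisym)
qed

fun branch_section :: "'z \<Rightarrow> bool list \<Rightarrow> bool \<Rightarrow> 'z" where
  "branch_section z [] b = (if b then nx (nx z) else nx z)"
| "branch_section z (c # p) b =
    (if b then nx (nx (op (branch_section z p c))) else nx (op (branch_section z p c)))"

text \<open>
  Values at the ends of a loop follow from \<open>nx\<close> alone and need not respect its edge. Along the infinite
  branches both permutations are respected.
\<close>

fun skeleton_section :: "('e \<Rightarrow> 'z) \<Rightarrow> 'e sk_end \<Rightarrow> 'z" where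
  "skeleton_section s (TreeEnd e) = s e"
| "skeleton_section s (LoopEnd v b) = (if b then nx (nx (s v)) else nx (s v))"
| "skeleton_section s (Down v p b) = branch_section (s v) p b"
| "skeleton_section s (Up v p b) = op (branch_section (s v) p b)"

lemma branch_section_closed: "z \<in> Z \<Longrightarrow> branch_section z p b \<in> Z"
  by (induction p arbitrary: b) (auto simp: op nx)

lemma skeleton_section_closed:
  assumes "section_on (ends \<Xi>) s" "u \<in> ends (Sk \<Xi> l)"
  shows "skeleton_section s u \<in> Z"
proof -
  have s: "s v \<in> Z" if "v \<in> ends \<Xi>" for v using assms(1) that by (auto simp: section_on_def)
  show ?thesis
    using assms(2) s nx(1) op(1) branch_section_closed by (cases u) (auto simp: Sk_def leaves_def)
qed

lemma skeleton_section_opp: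
  assumes s: "section_on (ends \<Xi>) s" and u: "u \<in> ends (Sk \<Xi> l)" and loop: "\<And>v b. u \<noteq> LoopEnd v b"
  shows "skeleton_section s (opp (Sk \<Xi> l) u) = op (skeleton_section s u)"
proof (cases u)
  case (TreeEnd e)
  then have "e \<in> ends \<Xi>" using u by (auto simp: Sk_def)
  then show ?thesis
    using s opp_closed[OF ribbon_graph_tree] by (auto simp: TreeEnd Sk_def section_on_def)
next
  case (Up v p b)
  then have "s v \<in> Z" using u s by (auto simp: Sk_def leaves_def section_on_def)
  then show ?thesis using branch_section_closed op by (simp add: Up Sk_def)
qed (use loop in \<open>auto simp: Sk_def\<close>)

lemma skeleton_section_nxt:
  assumes s: "section_on (ends \<Xi>) s" and u: "u \<in> ends (Sk \<Xi> l)"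
  shows "skeleton_section s (nxt (Sk \<Xi> l) u) = nx (skeleton_section s u)"
proof (cases u)
  case (TreeEnd e)
  then have "e \<in> ends \<Xi>" using u by (auto simp: Sk_def)
  then show ?thesis
    using s by (auto simp: TreeEnd Sk_def section_on_def split: leaf_label.split)
next
  case (LoopEnd v b)
  then have "v \<in> ends \<Xi>" using u by (auto simp: Sk_def leaves_def)
  then have "s v \<in> Z" using s by (auto simp: section_on_def)
  then show ?thesis using nx by (cases b) (auto simp: LoopEnd Sk_def)
next
  case (Down v p b)
  then have v: "v \<in> ends \<Xi>" "v \<in> leaves \<Xi>" "l v = Tri" using u by (auto simp: Sk_def leaves_def)
  then have "s v \<in> Z" using s by (auto simp: section_on_def)
  moreover have "skeleton_section s (Down v q c) \<in> Z" for q c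
    using skeleton_section_closed[OF s, of "Down v q c" l] v by (auto simp: Sk_def)
  ultimately show ?thesis using nx op by (cases p; cases b) (auto simp: Down Sk_def)
next
  case (Up v p b)
  then show ?thesis by (simp add: Sk_def)
qed

end

context free_product_subgroup
begin

interpretation H: subgroup H G by (rule H)

definition coset_ribbon where
  "coset_ribbon = \<lparr>ends = lcosets H, opp = (\<lambda>C. Y <# C), nxt = (\<lambda>C. inv X <# C)\<rparr>"

text \<open>
  A section of the tree with values in the group, on which \<open>op\<close> and \<open>nx\<close> act by left multiplication,
  extends to a section \<open>F\<close> on all cosets that respects every edge except the loops. Along a walk in
  the cut tree it is multiplied by the walk, so that the coset of \<open>g\<close> determines \<open>g\<close>.
\<close>

theorem pseudo_tree_imp_loops_cut_to_tree:
  assumes tree: "admissible_tree \<Xi>" and iso: "ribbon_iso coset_ribbon (Sk \<Xi> l)"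
  shows loops_cut_to_tree
proof -
  let ?op = "\<lambda>g. Y \<otimes> g" and ?nx = "\<lambda>g. inv X \<otimes> g"
  obtain f where bij: "bij_betw f (lcosets H) (ends (Sk \<Xi> l))"
    and f_op: "\<And>C. C \<in> lcosets H \<Longrightarrow> f (Y <# C) = opp (Sk \<Xi> l) (f C)"
    and f_nx: "\<And>C. C \<in> lcosets H \<Longrightarrow> f (inv X <# C) = nxt (Sk \<Xi> l) (f C)"
    using iso by (auto simp: ribbon_iso_def coset_ribbon_def)
  have coset: "g <# H \<in> lcosets H" if "g \<in> carrier G" for g
    using that by (auto simp: LCOSETS_def)
  have f_mem: "f (g <# H) \<in> ends (Sk \<Xi> l)" if "g \<in> carrier G" for g
    using bij coset[OF that] by (auto simp: bij_betw_def)
  have f_op': "f ((Y \<otimes> g) <# H) = opp (Sk \<Xi> l) (f (g <# H))" if "g \<in> carrier G" for g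
    using f_op[OF coset[OF that]] that by (simp add: lcos_m_assoc H.subset)
  have f_nx': "f ((inv X \<otimes> g) <# H) = nxt (Sk \<Xi> l) (f (g <# H))" if "g \<in> carrier G" for g
    using f_nx[OF coset[OF that]] that by (simp add: lcos_m_assoc H.subset)
  have f_inj: "g <# H = k <# H" if "f (g <# H) = f (k <# H)" "g \<in> carrier G" "k \<in> carrier G" for g k
    using bij coset that by (meson bij_betw_def inj_onD)
  have ops: "Y \<otimes> g \<in> carrier G" "Y \<otimes> (Y \<otimes> g) = g" "inv X \<otimes> g \<in> carrier G"
      "inv X \<otimes> (inv X \<otimes> (inv X \<otimes> g)) = g" if "g \<in> carrier G" for g
    using that by auto
  have ne: "carrier G \<noteq> {}" using X_closed by blast
  obtain s where s: "section_on \<Xi> ?op ?nx (carrier G) (ends \<Xi>) s"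
    using admissible_tree_section[OF tree, of "carrier G" ?op ?nx] ops ne by blast
  define F where "F g = skeleton_section ?op ?nx s (f (g <# H))" for g
  have F_closed: "F g \<in> carrier G" if "g \<in> carrier G" for g
    unfolding F_def
    by (rule skeleton_section_closed[OF tree ops(1,2) ops(3,4) ne s f_mem[OF that]])
  have not_loop: "loop_end g \<or> loop_end (Y \<otimes> g)" if g: "g \<in> carrier G" and "f (g <# H) = LoopEnd v b" for g v b
  proof (cases b)
    case False
    then have "f ((Y \<otimes> g) <# H) = f ((inv X \<otimes> g) <# H)"
      using g that f_op' f_nx' by (simp add: Sk_def)
    then show ?thesis using f_inj g by (simp add: loop_end_def)
  next
    case True
    then have "f ((inv X \<otimes> (Y \<otimes> g)) <# H) = f (g <# H)"
      using g that f_op' f_nx' by (simp add: Sk_def)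
    then show ?thesis using f_inj g by (simp add: loop_end_def)
  qed
  have F: "F g = g \<otimes> F \<one>" if "g \<in> cut_tree" for g
    using that
  proof induction
    case one
    then show ?case using F_closed by simp
  next
    case (X g)
    have g: "g \<in> carrier G" using X.hyps cut_tree_closed by blast
    have "F (inv X \<otimes> g) = inv X \<otimes> F g"
      unfolding F_def f_nx'[OF g]
      by (rule skeleton_section_nxt[OF tree ops(1,2) ops(3,4) ne s f_mem[OF g]])
    then show ?case using X g F_closed by (simp add: m_assoc)
  next
    case (Y g)
    have g: "g \<in> carrier G" using Y.hyps cut_tree_closed by blast
    have "f (g <# H) \<noteq> LoopEnd v b" for v b using not_loop[OF g] Y.hyps by blast
    then have "F (Y \<otimes> g) = Y \<otimes> F g"
      unfolding F_def f_op'[OF g]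
      by (intro skeleton_section_opp[OF tree ops(1,2) ops(3,4) ne s f_mem[OF g]])
    then show ?case using Y g F_closed by (simp add: m_assoc)
  qed
  show ?thesis
    unfolding loops_cut_to_tree_def
  proof (intro ballI impI)
    fix g k assume gk: "g \<in> cut_tree" "k \<in> cut_tree" "g <# H = k <# H"
    then have "g \<otimes> F \<one> = k \<otimes> F \<one>" using F by (metis F_def)
    then show "g = k" using gk cut_tree_closed F_closed by simp
  qed
qed

end

section \<open>The tree of paths to the loops\<close>

lemma vertex_at_period_3:
  assumes e: "nxt G (nxt G (nxt G e)) = e"
  shows "vertex_at G e = {e, nxt G e, nxt G (nxt G e)}"
proof -
  have 3: "(nxt G ^^ 3) e = e" by (simp add: numeral_3_eq_3 e)
  have "(nxt G ^^ k) e \<in> {e, nxt G e, nxt G (nxt G e)}" for k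
  proof -
    have "k mod 3 = 0 \<or> k mod 3 = 1 \<or> k mod 3 = 2" by linarith
    then show ?thesis
      unfolding funpow_mod_eq[OF 3, of k, symmetric]
      by (elim disjE) (simp_all add: numeral_2_eq_2)
  qed
  moreover have "nxt G e = (nxt G ^^ 1) e" "nxt G (nxt G e) = (nxt G ^^ 2) e"
    by (simp_all add: numeral_2_eq_2)
  ultimately show ?thesis
    using vertex_at_refl[of e G] unfolding vertex_at_def by blast
qed

text \<open>
  A skeleton in terms of its two permutations, with a chosen loop. Its vertices are explored from this
  loop without ever turning back.
\<close>

locale looped_skeleton =
  fixes E :: "'c set" and op nx :: "'c \<Rightarrow> 'c" and base_loop :: 'c
  assumes op_closed [simp]: "x \<in> E \<Longrightarrow> op x \<in> E" and op_op [simp]: "x \<in> E \<Longrightarrow> op (op x) = x"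
    and nx_closed [simp]: "x \<in> E \<Longrightarrow> nx x \<in> E" and nx_nx_nx [simp]: "x \<in> E \<Longrightarrow> nx (nx (nx x)) = x"
    and base_loop [simp]: "base_loop \<in> E" "op base_loop = nx base_loop"
    and loop_not_fixed: "x \<in> E \<Longrightarrow> op x = nx x \<Longrightarrow> nx x \<noteq> x"
begin

text \<open>
  From an end of a trivalent vertex to one of the two other ends.
\<close>

definition turn :: "bool \<Rightarrow> 'c \<Rightarrow> 'c" where
  "turn b x = (if b then nx (nx x) else nx x)"

text \<open>
  The address of a vertex lists the turns taken on the way from the base loop, the latest turn first.
  The value is the end at which the walk arrives at the vertex; it starts with the edge that leaves
  the base loop.
\<close>

primrec addr :: "bool list \<Rightarrow> 'c" where
  "addr [] = op (nx (nx base_loop))"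
| "addr (b # p) = op (turn b (addr p))"

text \<open>
  The two other ends at the vertex of \<open>x\<close> form a loop.
\<close>

definition at_loop :: "'c \<Rightarrow> bool" where
  "at_loop x \<longleftrightarrow> op (nx x) = nx (nx x)"

text \<open>
  The walk passes no vertex with a loop before its end.
\<close>

primrec reach :: "bool list \<Rightarrow> bool" where
  "reach [] = True"
| "reach (b # p) = (reach p \<and> \<not> at_loop (addr p))"

definition tip :: "bool list \<Rightarrow> bool" where
  "tip p \<longleftrightarrow> reach p \<and> at_loop (addr p)"

text \<open>
  The vertices strictly between the base loop and another loop.
\<close>

definition inner :: "bool list \<Rightarrow> bool" where
  "inner p \<longleftrightarrow> (\<exists>q. q \<noteq> [] \<and> tip (q @ p))"

text \<open>
  The vertices of the tree spanned by the paths to the loops, and their neighbours.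
\<close>

primrec node :: "bool list \<Rightarrow> bool" where
  "node [] = True"
| "node (b # p) = inner p"

lemma turn_closed [simp]: "x \<in> E \<Longrightarrow> turn b x \<in> E"
  by (simp add: turn_def)

lemma addr_closed [simp]: "addr p \<in> E"
  by (induction p) simp_all

lemma nx_inj: "x \<in> E \<Longrightarrow> y \<in> E \<Longrightarrow> nx x = nx y \<longleftrightarrow> x = y"
  by (metis nx_nx_nx)

lemma reach_append: "reach (q @ p) \<Longrightarrow> reach p"
  by (induction q) auto

lemma inner_reach:
  assumes "inner p" shows "reach p" "\<not> at_loop (addr p)"
proof -
  obtain q where q: "q \<noteq> []" "tip (q @ p)" using assms by (auto simp: inner_def)
  then obtain q' b where "q = q' @ [b]" by (metis rev_exhaust)
  then have "reach (q' @ b # p)" using q by (simp add: tip_def)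
  from reach_append[OF this] show "reach p" "\<not> at_loop (addr p)" by simp_all
qed

lemma inner_ConsD: "inner (b # p) \<Longrightarrow> inner p"
  unfolding inner_def by (metis append.assoc append_Cons append_Nil snoc_eq_iff_butlast)

lemma inner_node: "inner p \<Longrightarrow> node p"
  by (cases p) (auto dest: inner_ConsD)

lemma node_reach: "node p \<Longrightarrow> reach p"
  by (cases p) (auto dest: inner_reach)

lemma tip_node: "tip p \<Longrightarrow> node p"
proof (cases p)
  case (Cons b q)
  assume "tip p"
  then show ?thesis using Cons by (auto simp: inner_def intro: exI[of _ "[b]"])
qed simp

lemma tip_not_inner: "tip p \<Longrightarrow> \<not> inner p"
  using inner_reach(2) by (auto simp: tip_def)

lemma inner_child:
  assumes "inner p" obtains b where "inner (b # p) \<or> tip (b # p)"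
proof -
  obtain q where q: "q \<noteq> []" "tip (q @ p)" using assms by (auto simp: inner_def)
  then obtain q' b where "q = q' @ [b]" by (metis rev_exhaust)
  then have "tip (q' @ b # p)" using q by simp
  then have "inner (b # p) \<or> tip (b # p)" unfolding inner_def by (cases "q' = []") auto
  then show thesis by (rule that)
qed

definition off_loops :: "'c \<Rightarrow> bool" where
  "off_loops x \<longleftrightarrow> op x \<noteq> nx x \<and> nx (op x) \<noteq> x"

lemma off_loops_op: "x \<in> E \<Longrightarrow> off_loops x \<Longrightarrow> off_loops (op x)"
  by (auto simp: off_loops_def)

lemma op_eqD: "x \<in> E \<Longrightarrow> op x = y \<Longrightarrow> op y = x"
  by auto

text \<open>
  If the edge of \<open>x\<close> is no loop and the other two ends do not form one, no end of this vertex
  belongs to a loop.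
\<close>

lemma off_loops_turn:
  assumes x: "x \<in> E" and off: "off_loops x" "\<not> at_loop x"
  shows "off_loops (turn b x)"
proof -
  have "nx (op (nx x)) \<noteq> nx x"
  proof
    assume "nx (op (nx x)) = nx x"
    then have "op (nx x) = x" using x nx_inj by simp
    then have "op x = nx x" using op_eqD[of "nx x" x] x by simp
    then show False using off(1) by (simp add: off_loops_def)
  qed
  moreover have "op (nx (nx x)) \<noteq> x"
  proof
    assume "op (nx (nx x)) = x"
    then have "op x = nx (nx x)" using op_eqD[of "nx (nx x)" x] x by simp
    then have "nx (op x) = x" using x by simp
    then show False using off(1) by (simp add: off_loops_def)
  qed
  moreover have "nx (op (nx (nx x))) \<noteq> nx (nx x)"
  proof
    assume "nx (op (nx (nx x))) = nx (nx x)"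
    then have "op (nx (nx x)) = nx x" using x nx_inj by simp
    then have "op (nx x) = nx (nx x)" using op_eqD[of "nx (nx x)" "nx x"] x by simp
    then show False using off(2) by (simp add: at_loop_def)
  qed
  ultimately show ?thesis using x off(2) by (auto simp: turn_def off_loops_def at_loop_def)
qed

lemma root_off_loops: "off_loops (nx (nx base_loop))"
proof -
  let ?b = base_loop
  have ne: "nx ?b \<noteq> ?b" using loop_not_fixed[OF base_loop] .
  have "op (nx (nx ?b)) \<noteq> ?b"
  proof
    assume "op (nx (nx ?b)) = ?b"
    then have "nx (nx ?b) = nx ?b" using op_eqD[of "nx (nx ?b)" ?b] by simp
    then show False using ne nx_inj[of "nx ?b" ?b] by simp
  qed
  moreover have "nx (op (nx (nx ?b))) \<noteq> nx (nx ?b)"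
  proof
    assume "nx (op (nx (nx ?b))) = nx (nx ?b)"
    then have "op (nx (nx ?b)) = nx ?b" using nx_inj by simp
    moreover have "op (nx ?b) = ?b" using op_eqD[of ?b "nx ?b"] by simp
    ultimately have "nx (nx ?b) = ?b" using op_eqD[of "nx (nx ?b)" "nx ?b"] by simp
    then show False using ne nx_nx_nx[of ?b] by simp
  qed
  ultimately show ?thesis by (simp add: off_loops_def)
qed

lemma reach_off_loops: "reach p \<Longrightarrow> off_loops (addr p)"
  by (induction p) (simp_all add: off_loops_op root_off_loops off_loops_turn)

text \<open>
  Beyond a node that leads to no loop there are no loops at all, and the walks continue forever.
\<close>

lemma barren_branch:
  assumes "node p" "\<not> inner p" "\<not> tip p"
  shows "reach (q @ p) \<and> \<not> at_loop (addr (q @ p))"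
proof (induction q)
  case Nil
  then show ?case using assms node_reach[of p] by (simp add: tip_def)
next
  case (Cons b q)
  then have r: "reach ((b # q) @ p)" by simp
  moreover have "\<not> tip ((b # q) @ p)" using assms(2) unfolding inner_def by blast
  ultimately show ?case by (simp add: tip_def)
qed

text \<open>
  The ends of the spanned tree are pairs \<open>(up, p)\<close>. Each vertex \<open>p\<close> has an edge towards the base loop;
  \<open>(True, p)\<close> is its end at \<open>p\<close> and \<open>(False, p)\<close> the opposite end, so that \<open>(False, [])\<close> is the leaf at
  the base loop and \<open>(False, b # p)\<close> lies at \<open>p\<close>.
\<close>

fun spine_nxt :: "bool \<times> bool list \<Rightarrow> bool \<times> bool list" where
  "spine_nxt (True, p) = (if inner p then (False, False # p) else (True, p))"
| "spine_nxt (False, []) = (False, [])"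
| "spine_nxt (False, False # p) = (False, True # p)"
| "spine_nxt (False, True # p) = (True, p)"

definition spine :: "nat ribbon" where
  "spine = \<lparr>ends = to_nat ` ((UNIV :: bool set) \<times> Collect node),
     opp = (\<lambda>n. to_nat (apfst Not (from_nat n :: bool \<times> bool list))),
     nxt = (\<lambda>n. to_nat (spine_nxt (from_nat n)))\<rparr>"

definition spine_label :: "nat \<Rightarrow> leaf_label" where
  "spine_label n = (case from_nat n of (up, p) \<Rightarrow> if up \<and> \<not> tip p then Tri else Zero)"

abbreviation end_at :: "bool \<Rightarrow> bool list \<Rightarrow> nat" where
  "end_at up p \<equiv> to_nat (up, p)"

lemma spine_simps [simp]:
  "opp spine (end_at u p) = end_at (\<not> u) p"
  "nxt spine (end_at u p) = to_nat (spine_nxt (u, p))"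
  "end_at u p \<in> ends spine \<longleftrightarrow> node p"
  by (auto simp: spine_def)

lemma spine_label_end_at [simp]: "spine_label (end_at u p) = (if u \<and> \<not> tip p then Tri else Zero)"
  by (simp add: spine_label_def)

lemma spine_ends_cases:
  assumes "e \<in> ends spine"
  obtains (up) p where "e = end_at True p" "node p"
  | (root) "e = end_at False []"
  | (down) b p where "e = end_at False (b # p)" "inner p"
proof -
  obtain u p where "e = end_at u p" "node p" using assms by (auto simp: spine_def)
  then show thesis using up root down by (cases u; cases p) auto
qed

lemma vertex_at_spine:
  "inner p \<Longrightarrow> vertex_at spine (end_at True p) = {end_at True p, end_at False (False # p), end_at False (True # p)}"
  "inner p \<Longrightarrow> vertex_at spine (end_at False (b # p)) =
    {end_at True p, end_at False (False # p), end_at False (True # p)}"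
  "\<not> inner p \<Longrightarrow> vertex_at spine (end_at True p) = {end_at True p}"
  "vertex_at spine (end_at False []) = {end_at False []}"
  by (subst vertex_at_period_3; cases b; force)+

lemma leaves_spine:
  "end_at u p \<in> leaves spine \<longleftrightarrow> node p \<and> (if u then \<not> inner p else p = [])"
proof (cases "node p")
  case True
  then show ?thesis
    by (cases u; cases p; cases "inner p") (auto simp: leaves_def vertex_at_spine)
qed (simp add: leaves_def)

lemma leavesE:
  assumes "v \<in> leaves spine"
  obtains (root) "v = end_at False []"
  | (tip) p where "v = end_at True p" "tip p"
  | (barren) p where "v = end_at True p" "node p" "\<not> inner p" "\<not> tip p"
proof -
  have "v \<in> ends spine" using assms by (simp add: leaves_def)
  then show thesis
  proof (cases rule: spine_ends_cases)
    case (up p)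
    then show ?thesis using assms tip barren leaves_spine by (cases "tip p") auto
  next
    case (down b p)
    then show ?thesis using assms leaves_spine by auto
  qed (rule root)
qed

lemma spine_nxt_closed: "e \<in> ends spine \<Longrightarrow> nxt spine e \<in> ends spine"
  and spine_nxt_cubed: "e \<in> ends spine \<Longrightarrow> nxt spine (nxt spine (nxt spine e)) = e"
proof -
  assume "e \<in> ends spine"
  then have "nxt spine e \<in> ends spine \<and> nxt spine (nxt spine (nxt spine e)) = e"
  proof (cases rule: spine_ends_cases)
    case (down b p)
    then show ?thesis using inner_node by (cases b) auto
  qed auto
  then show "nxt spine e \<in> ends spine" "nxt spine (nxt spine (nxt spine e)) = e" by auto
qed

lemma spine_opp_closed: "e \<in> ends spine \<Longrightarrow> opp spine e \<in> ends spine"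
  and spine_opp_opp: "e \<in> ends spine \<Longrightarrow> opp spine (opp spine e) = e"
  and spine_opp_neq: "e \<in> ends spine \<Longrightarrow> opp spine e \<noteq> e"
  by (auto elim!: spine_ends_cases)

text \<open>
  Connectedness as an induction principle. The step at a leaf is omitted since the skeleton
  continues differently there.
\<close>

lemma spine_closed_subset:
  assumes root: "end_at False [] \<in> A"
    and step: "\<And>e. e \<in> A \<Longrightarrow> e \<in> ends spine \<Longrightarrow> opp spine e \<in> A"
      "\<And>e. e \<in> A \<Longrightarrow> e \<in> ends spine - leaves spine \<Longrightarrow> nxt spine e \<in> A"
  shows "ends spine \<subseteq> A"
proof -
  have "node p \<Longrightarrow> end_at False p \<in> A \<and> end_at True p \<in> A" for p
  proof (induction p)
    case Nil
    then show ?case using root step(1)[OF root] by simp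
  next
    case (Cons b p)
    then have p: "inner p" "end_at True p \<in> A" using inner_node by auto
    then have F: "end_at False (False # p) \<in> A"
      using step(2)[of "end_at True p"] inner_node leaves_spine by auto
    then have "end_at False (True # p) \<in> A"
      using step(2)[of "end_at False (False # p)"] p leaves_spine by auto
    with F have "end_at False (b # p) \<in> A" by (cases b) auto
    then show ?case using step(1)[of "end_at False (b # p)"] p by simp
  qed
  then show ?thesis by (auto simp: spine_def) (metis (full_types))
qed

lemma ribbon_graph_spine: "ribbon_graph spine"
  unfolding ribbon_graph_def
proof (intro conjI ballI)
  show "bij_betw (opp spine) (ends spine) (ends spine)"
    by (rule bij_betwI[where g = "opp spine"]) (auto simp: spine_opp_closed spine_opp_opp)
  show "bij_betw (nxt spine) (ends spine) (ends spine)"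
    by (rule bij_betwI[where g = "\<lambda>e. nxt spine (nxt spine e)"])
      (auto simp: spine_nxt_closed spine_nxt_cubed)
  show "finite (vertex_at spine e)" if "e \<in> ends spine" for e
    using vertex_at_period_3[OF spine_nxt_cubed[OF that]] by simp
qed (simp_all add: spine_opp_neq spine_opp_opp)

lemma connected_spine: "connected_ribbon spine"
proof -
  let ?R = "{(x, opp spine x) | x. x \<in> ends spine} \<union> {(x, nxt spine x) | x. x \<in> ends spine}"
  have R: "(e, opp spine e) \<in> ?R" "(e, nxt spine e) \<in> ?R" if "e \<in> ends spine" for e
    using that by auto
  have reverse: "(opp spine e, e) \<in> ?R\<^sup>*" "(nxt spine e, e) \<in> ?R\<^sup>*" if e: "e \<in> ends spine" for e
  proof -
    show "(opp spine e, e) \<in> ?R\<^sup>*"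
      using R(1)[OF spine_opp_closed[OF e]] spine_opp_opp[OF e] by auto
    have "(nxt spine e, nxt spine (nxt spine e)) \<in> ?R" "(nxt spine (nxt spine e), e) \<in> ?R"
      using R(2)[of "nxt spine e"] R(2)[of "nxt spine (nxt spine e)"] e spine_nxt_closed spine_nxt_cubed[OF e] by auto
    then show "(nxt spine e, e) \<in> ?R\<^sup>*" by (meson r_into_rtrancl rtrancl_trans)
  qed
  have "ends spine \<subseteq> {f. (end_at False [], f) \<in> ?R\<^sup>*}"
    by (rule spine_closed_subset) (use R in \<open>auto intro: rtrancl_into_rtrancl\<close>)
  moreover have "ends spine \<subseteq> {f. (f, end_at False []) \<in> ?R\<^sup>*}"
    by (rule spine_closed_subset) (use reverse in \<open>blast intro: rtrancl_trans\<close>)+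
  ultimately show ?thesis unfolding connected_ribbon_def by (blast intro: rtrancl_trans)
qed

text \<open>
  The address of the vertex of an end; \<open>None\<close> is the vertex of the base loop.
\<close>

definition vertex_of :: "nat \<Rightarrow> bool list option" where
  "vertex_of n = (case from_nat n of (up, p) \<Rightarrow> if up then Some p else (case p of [] \<Rightarrow> None | _ # q \<Rightarrow> Some q))"

lemma vertex_of_nxt: "e \<in> ends spine \<Longrightarrow> vertex_of (nxt spine e) = vertex_of e"
proof (erule spine_ends_cases)
  fix b p assume "e = end_at False (b # p)" "inner p"
  then show ?thesis by (cases b) (auto simp: vertex_of_def)
qed (auto simp: vertex_of_def)

lemma vertex_of_cong:
  assumes e: "e \<in> ends spine" and eq: "vertex_at spine e = vertex_at spine f"
  shows "vertex_of f = vertex_of e"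
proof -
  have "f \<in> vertex_at spine e" using eq by simp
  then show ?thesis
    using vertex_at_period_3[OF spine_nxt_cubed[OF e]] e by (auto simp: vertex_of_nxt spine_nxt_closed)
qed

text \<open>
  At a vertex of largest depth on a cycle, both the arriving and the leaving edge would be the one
  towards the base loop.
\<close>

lemma acyclic_spine: "\<not> ribbon_cycle spine es"
proof
  assume cycle: "ribbon_cycle spine es"
  define depth where "depth n = (case vertex_of n of None \<Rightarrow> 0 | Some p \<Rightarrow> Suc (length p))" for n
  have es: "es \<noteq> []" "set es \<subseteq> ends spine" "\<forall>e\<in>set es. opp spine e \<notin> set es"
    and step: "\<And>i. i < length es \<Longrightarrow> vertex_at spine (opp spine (es ! i)) = vertex_at spine (es ! (Suc i mod length es))"
    using cycle by (auto simp: ribbon_cycle_def)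
  obtain e where e: "e \<in> set es" "\<And>f. f \<in> set es \<Longrightarrow> depth f \<le> depth e"
  proof -
    have "Max (depth ` set es) \<in> depth ` set es" using es(1) by (intro Max_in) auto
    then show thesis using that by (metis (no_types, lifting) List.finite_set Max_ge finite_imageI image_iff)
  qed
  obtain i where i: "i < length es" "es ! i = e" using e(1) by (auto simp: in_set_conv_nth)
  \<comment> \<open>the cyclic predecessor of \<open>i\<close>\<close>
  define j where "j = (if i = 0 then length es - 1 else i - 1)"
  have j: "j < length es" "Suc j mod length es = i"
    using i(1) by (auto simp: j_def)
  let ?next = "es ! (Suc i mod length es)" and ?prev = "es ! j"
  have mem: "?next \<in> set es" "?prev \<in> set es" using i j es(1) by auto
  have ends: "e \<in> ends spine" "?prev \<in> ends spine" using e(1) mem(2) es(2) by blast+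
  have next_v: "vertex_of ?next = vertex_of (opp spine e)"
    by (rule vertex_of_cong[OF spine_opp_closed[OF ends(1)]]) (use step[OF i(1)] i(2) in simp)
  have prev_v: "vertex_of e = vertex_of (opp spine ?prev)"
    by (rule vertex_of_cong[OF spine_opp_closed[OF ends(2)]]) (use step[OF j(1)] j(2) i(2) in simp)
  have depth_next: "depth (opp spine e) \<le> depth e" using e(2)[OF mem(1)] next_v by (simp add: depth_def)
  have depth_prev: "depth ?prev \<le> depth (opp spine ?prev)"
    using e(2)[OF mem(2)] prev_v by (simp add: depth_def)
  obtain u p where up: "e = end_at u p" using e(1) es(2) by (auto simp: spine_def)
  obtain u' p' where up': "?prev = end_at u' p'" using mem(2) es(2) by (auto simp: spine_def)
  have u: "u" using depth_next unfolding up
    by (cases u; cases p) (auto simp: depth_def vertex_of_def)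
  have u': "\<not> u'" using depth_prev unfolding up'
    by (cases u'; cases p') (auto simp: depth_def vertex_of_def)
  have "p = p'" using prev_v u u' by (simp add: up up' vertex_of_def)
  then have "opp spine ?prev = e" using u u' by (simp add: up up')
  then show False using es(3) mem(2) e(1) by blast
qed

text \<open>
  An inner vertex lies on the way to a loop, so at least one of its two children is inner or carries a
  loop; hence no two leaves labelled \<open>Tri\<close> are adjacent to it.
\<close>

lemma admissible_labelling_spine: "admissible_labelling spine spine_label"
  unfolding admissible_labelling_def
proof (intro ballI impI, elim conjE)
  fix v w assume vw: "v \<in> leaves spine" "w \<in> leaves spine" "v \<noteq> w"
    and tri: "spine_label v = Tri" "spine_label w = Tri"
  obtain p where p: "v = end_at True p" "node p" "\<not> inner p" "\<not> tip p"
    using vw(1) tri(1) by (cases rule: leavesE) auto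
  obtain q where q: "w = end_at True q" "node q" "\<not> inner q" "\<not> tip q"
    using vw(2) tri(2) by (cases rule: leavesE) auto
  show "vertex_at spine (opp spine v) \<noteq> vertex_at spine (opp spine w)"
  proof
    assume "vertex_at spine (opp spine v) = vertex_at spine (opp spine w)"
    then have "vertex_of (opp spine w) = vertex_of (opp spine v)"
      by (rule vertex_of_cong[rotated]) (simp add: p)
    then obtain b c r where r: "p = b # r" "q = c # r" "b \<noteq> c"
      using vw(3) by (cases p; cases q) (auto simp: p(1) q(1) vertex_of_def)
    then obtain d where "inner (d # r) \<or> tip (d # r)" using p(2) inner_child by (metis node.simps(2))
    moreover have "d = b \<or> d = c" using r(3) by auto
    ultimately show False using p q r by auto
  qed
qed

text \<open>
  Addresses of inner vertices are final segments of addresses of loops.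
\<close>

lemma finite_spine:
  assumes "finite (Collect tip)"
  shows "finite (ends spine)"
proof -
  have "Collect inner \<subseteq> (\<Union>t\<in>Collect tip. (\<lambda>n. drop n t) ` {..length t})"
  proof
    fix p assume "p \<in> Collect inner"
    then obtain q where "tip (q @ p)" by (auto simp: inner_def)
    moreover have "p \<in> (\<lambda>n. drop n (q @ p)) ` {..length (q @ p)}"
      by (rule image_eqI[of _ _ "length q"]) auto
    ultimately show "p \<in> (\<Union>t\<in>Collect tip. (\<lambda>n. drop n t) ` {..length t})" by blast
  qed
  then have "finite (Collect inner)" by (rule finite_subset) (use assms in auto)
  moreover have "Collect node \<subseteq> insert [] ((\<lambda>(b, p). b # p) ` (UNIV \<times> Collect inner))"
  proof
    fix p assume "p \<in> Collect node"
    then show "p \<in> insert [] ((\<lambda>(b, p). b # p) ` (UNIV \<times> Collect inner))" by (cases p) auto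
  qed
  ultimately have "finite (Collect node)" by (auto intro: finite_subset)
  then show ?thesis by (simp add: spine_def)
qed

lemma admissible_tree_spine:
  assumes "finite (Collect tip)"
  shows "admissible_tree spine"
  unfolding admissible_tree_def
proof (intro conjI ballI)
  show "ends spine \<noteq> {}" using spine_simps(3)[of True "[]"] by force
  show "card (vertex_at spine e) = 1 \<or> card (vertex_at spine e) = 3" if "e \<in> ends spine" for e
    using that
  proof (cases rule: spine_ends_cases)
    case (up p)
    then show ?thesis by (cases "inner p") (auto simp: vertex_at_spine)
  qed (auto simp: vertex_at_spine)
qed (auto simp: ribbon_graph_spine finite_spine[OF assms] connected_spine acyclic_spine)

abbreviation "spine_skeleton \<equiv> Sk spine spine_label"

lemma spine_skeleton_cases [consumes 1, case_names tree_end root_loop tip_loop down up]: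
  assumes "u \<in> ends spine_skeleton"
  obtains e where "u = TreeEnd e" "e \<in> ends spine"
  | b where "u = LoopEnd (end_at False []) b"
  | p b where "u = LoopEnd (end_at True p) b" "tip p"
  | p q b where "u = Down (end_at True p) q b" "node p" "\<not> inner p" "\<not> tip p"
  | p q b where "u = Up (end_at True p) q b" "node p" "\<not> inner p" "\<not> tip p"
  using assms by (cases u) (auto simp: Sk_def elim!: leavesE)

lemma spine_skeleton_ends [simp]:
  "TreeEnd e \<in> ends spine_skeleton \<longleftrightarrow> e \<in> ends spine"
  "LoopEnd (end_at False []) b \<in> ends spine_skeleton"
  "tip p \<Longrightarrow> LoopEnd (end_at True p) b \<in> ends spine_skeleton"
  "node p \<Longrightarrow> \<not> inner p \<Longrightarrow> \<not> tip p \<Longrightarrow> Down (end_at True p) q b \<in> ends spine_skeleton"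
  "node p \<Longrightarrow> \<not> inner p \<Longrightarrow> \<not> tip p \<Longrightarrow> Up (end_at True p) q b \<in> ends spine_skeleton"
  by (auto simp: Sk_def leaves_spine tip_node tip_not_inner)

lemma opp_spine_skeleton [simp]: "opp spine_skeleton = sk_opp spine"
  and nxt_spine_skeleton [simp]: "nxt spine_skeleton = sk_nxt spine spine_label"
  by (simp_all add: Sk_def)

text \<open>
  The covering of the given skeleton by that of the spanned tree. On an infinite branch the address of
  the leaf, where the branch starts, is extended by the position in the branch.
\<close>

fun develop :: "nat sk_end \<Rightarrow> 'c" where
  "develop (TreeEnd n) = (case from_nat n of (up, p) \<Rightarrow> if up then addr p else op (addr p))"
| "develop (LoopEnd n b) = turn b (case from_nat n of (up, p) \<Rightarrow> if up then addr p else op (addr p))"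
| "develop (Down n q b) = turn b (addr (q @ snd (from_nat n :: bool \<times> bool list)))"
| "develop (Up n q b) = addr (b # q @ snd (from_nat n :: bool \<times> bool list))"

lemma develop_closed [simp]: "develop u \<in> E"
  by (cases u) (auto split: prod.split)

lemma op_turn_at_loop: "x \<in> E \<Longrightarrow> at_loop x \<Longrightarrow> op (turn b x) = turn (\<not> b) x"
  using op_op[of "nx x"] by (auto simp: turn_def at_loop_def)

lemma at_loop_root: "at_loop (nx (nx base_loop))"
  by (simp add: at_loop_def)

lemma spine_skeleton_opp:
  assumes "u \<in> ends spine_skeleton"
  shows "sk_opp spine u \<in> ends spine_skeleton" "sk_opp spine (sk_opp spine u) = u"
    "develop (sk_opp spine u) = op (develop u)"
proof -
  have "sk_opp spine u \<in> ends spine_skeleton \<and> sk_opp spine (sk_opp spine u) = u \<and>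
      develop (sk_opp spine u) = op (develop u)"
    using assms
  proof (cases rule: spine_skeleton_cases)
    case (tree_end e)
    obtain up p where "e = end_at up p" "node p" using tree_end by (auto simp: spine_def)
    then show ?thesis using tree_end by auto
  next
    case (root_loop b)
    then show ?thesis by (auto simp: op_turn_at_loop at_loop_root)
  next
    case (tip_loop p b)
    then show ?thesis by (auto simp: op_turn_at_loop tip_def)
  qed auto
  then show "sk_opp spine u \<in> ends spine_skeleton" "sk_opp spine (sk_opp spine u) = u"
    "develop (sk_opp spine u) = op (develop u)" by auto
qed

lemma spine_skeleton_nxt:
  assumes "u \<in> ends spine_skeleton"
  shows "sk_nxt spine spine_label u \<in> ends spine_skeleton"
    "sk_nxt spine spine_label (sk_nxt spine spine_label (sk_nxt spine spine_label u)) = u"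
    "develop (sk_nxt spine spine_label u) = nx (develop u)"
proof -
  have "sk_nxt spine spine_label u \<in> ends spine_skeleton \<and>
      sk_nxt spine spine_label (sk_nxt spine spine_label (sk_nxt spine spine_label u)) = u \<and>
      develop (sk_nxt spine spine_label u) = nx (develop u)"
    using assms
  proof (cases rule: spine_skeleton_cases)
    case (tree_end e)
    from tree_end(2) show ?thesis
    proof (cases rule: spine_ends_cases)
      case (up p)
      then show ?thesis using tree_end tip_not_inner
        by (cases "inner p"; cases "tip p") (auto simp: leaves_spine turn_def inner_node)
    next
      case root
      then show ?thesis using tree_end by (auto simp: leaves_spine turn_def)
    next
      case (down b p)
      then show ?thesis using tree_end by (cases b) (auto simp: leaves_spine turn_def inner_node)
    qed
  next
    case (root_loop b)
    then show ?thesis by (cases b) (auto simp: leaves_spine turn_def)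
  next
    case (tip_loop p b)
    then show ?thesis using tip_not_inner tip_node by (cases b) (auto simp: leaves_spine turn_def)
  next
    case (down p q b)
    then show ?thesis by (cases b; cases q) (auto simp: leaves_spine turn_def)
  next
    case (up p q b)
    then show ?thesis by (auto simp: leaves_spine turn_def)
  qed
  then show "sk_nxt spine spine_label u \<in> ends spine_skeleton"
    "sk_nxt spine spine_label (sk_nxt spine spine_label (sk_nxt spine spine_label u)) = u"
    "develop (sk_nxt spine spine_label u) = nx (develop u)" by auto
qed

text \<open>
  Ends of the tree and of the infinite branches are mapped to ends off the loops, the latter because
  the branches are barren.
\<close>

lemma develop_loop_lifts:
  assumes u: "u \<in> ends spine_skeleton" and loop: "op (develop u) = nx (develop u)"
  shows "sk_opp spine u = sk_nxt spine spine_label u"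
proof -
  have off: "\<not> off_loops (develop u)" using loop by (simp add: off_loops_def)
  have second: False if x: "x \<in> E" "at_loop x" "op (turn True x) = nx (turn True x)" for x
  proof -
    have "nx x = x" using x by (simp add: op_turn_at_loop) (simp add: turn_def)
    moreover from this have "op x = x" using x(2) by (simp add: at_loop_def)
    ultimately show False using loop_not_fixed[OF x(1)] by simp
  qed
  show ?thesis
    using u
  proof (cases rule: spine_skeleton_cases)
    case (tree_end e)
    obtain up p where e: "e = end_at up p" "node p" using tree_end by (auto simp: spine_def)
    then have "off_loops (develop u)"
      using reach_off_loops[OF node_reach] off_loops_op by (auto simp: tree_end)
    then show ?thesis using off by blast
  next
    case (root_loop b)
    then show ?thesis using second[of "nx (nx base_loop)"] loop by (cases b) (auto simp: at_loop_root)
  next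
    case (tip_loop p b)
    then show ?thesis using second[of "addr p"] loop by (cases b) (auto simp: tip_def)
  next
    case (down p q b)
    then have "off_loops (develop u)"
      using barren_branch[of p q] reach_off_loops off_loops_turn by auto
    then show ?thesis using off by blast
  next
    case (up p q b)
    then have "off_loops (develop u)"
      using barren_branch[of p "b # q"] reach_off_loops[of "(b # q) @ p"] by auto
    then show ?thesis using off by blast
  qed
qed

lemma spine_skeleton_closed_subset:
  assumes root: "TreeEnd (end_at False []) \<in> A"
    and step: "\<And>u. u \<in> A \<Longrightarrow> u \<in> ends spine_skeleton \<Longrightarrow> sk_opp spine u \<in> A"
      "\<And>u. u \<in> A \<Longrightarrow> u \<in> ends spine_skeleton \<Longrightarrow> sk_nxt spine spine_label u \<in> A"
  shows "ends spine_skeleton \<subseteq> A"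
proof
  have tree: "TreeEnd e \<in> A" if "e \<in> ends spine" for e
  proof -
    have "ends spine \<subseteq> {e. TreeEnd e \<in> A}"
    proof (rule spine_closed_subset)
      show "opp spine e \<in> {e. TreeEnd e \<in> A}" if "e \<in> {e. TreeEnd e \<in> A}" "e \<in> ends spine" for e
        using step(1)[of "TreeEnd e"] that by simp
      show "nxt spine e \<in> {e. TreeEnd e \<in> A}" if "e \<in> {e. TreeEnd e \<in> A}" "e \<in> ends spine - leaves spine" for e
        using step(2)[of "TreeEnd e"] that by simp
    qed (use root in simp)
    then show ?thesis using that by blast
  qed
  fix u assume u: "u \<in> ends spine_skeleton"
  have loops: "LoopEnd v b \<in> A"
    if v: "v \<in> leaves spine" "spine_label v = Zero" and mem: "\<And>b. LoopEnd v b \<in> ends spine_skeleton" for v b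
  proof -
    have "LoopEnd v False \<in> A" using step(2)[of "TreeEnd v"] tree[of v] v by (simp add: leaves_def)
    moreover from this have "LoopEnd v True \<in> A" using step(2)[of "LoopEnd v False"] mem by simp
    ultimately show ?thesis by (cases b) auto
  qed
  have branch: "Down (end_at True p) q b \<in> A \<and> Up (end_at True p) q b \<in> A"
    if p: "node p" "\<not> inner p" "\<not> tip p" for p q b
  proof (induction q arbitrary: b)
    case Nil
    have F: "Down (end_at True p) [] False \<in> A"
      using step(2)[of "TreeEnd (end_at True p)"] tree[of "end_at True p"] p by (simp add: leaves_spine)
    then have "Down (end_at True p) [] b \<in> A"
      using step(2)[OF F] p by (cases b) auto
    then show ?case using step(1)[of "Down (end_at True p) [] b"] p by simp
  next
    case (Cons c q)
    then have "Up (end_at True p) q c \<in> A" by blast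
    then have F: "Down (end_at True p) (c # q) False \<in> A"
      using step(2)[of "Up (end_at True p) q c"] p by simp
    then have "Down (end_at True p) (c # q) b \<in> A"
      using step(2)[OF F] p by (cases b) auto
    then show ?case using step(1)[of "Down (end_at True p) (c # q) b"] p by simp
  qed
  from u show "u \<in> A"
  proof (cases rule: spine_skeleton_cases)
    case (tip_loop p b)
    then show ?thesis using loops[of "end_at True p"] tip_node tip_not_inner by (simp add: leaves_spine)
  qed (auto simp: tree loops leaves_spine branch)
qed

text \<open>
  Different addresses of loops give different loops if the covering is injective.
\<close>

lemma finite_tips:
  assumes inj: "inj_on develop (ends spine_skeleton)" and fin: "finite {x \<in> E. op x = nx x}"
  shows "finite (Collect tip)"
proof (rule finite_imageD)
  show "finite ((\<lambda>p. nx (addr p)) ` Collect tip)"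
    by (rule finite_subset[OF _ fin]) (auto simp: tip_def at_loop_def)
  show "inj_on (\<lambda>p. nx (addr p)) (Collect tip)"
  proof (rule inj_onI)
    fix p q assume pq: "p \<in> Collect tip" "q \<in> Collect tip" "nx (addr p) = nx (addr q)"
    then have "develop (TreeEnd (end_at True p)) = develop (TreeEnd (end_at True q))"
      using nx_inj[of "addr p" "addr q"] by simp
    then have "TreeEnd (end_at True p) = TreeEnd (end_at True q)"
      using pq tip_node by (intro inj_onD[OF inj]) auto
    then show "p = q" by simp
  qed
qed

end

section \<open>Subgroups generated by loops\<close>

lemma ribbon_iso_sym:
  assumes f: "bij_betw f (ends S) (ends T)"
    and hom: "\<And>e. e \<in> ends S \<Longrightarrow> f (opp S e) = opp T (f e)" "\<And>e. e \<in> ends S \<Longrightarrow> f (nxt S e) = nxt T (f e)"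
    and closed: "\<And>e. e \<in> ends S \<Longrightarrow> opp S e \<in> ends S" "\<And>e. e \<in> ends S \<Longrightarrow> nxt S e \<in> ends S"
  shows "ribbon_iso T S"
  unfolding ribbon_iso_def
proof (intro exI conjI ballI)
  let ?g = "the_inv_into (ends S) f"
  have inj: "inj_on f (ends S)" and img: "f ` ends S = ends T" using f by (auto simp: bij_betw_def)
  show "bij_betw ?g (ends T) (ends S)" by (rule bij_betw_the_inv_into[OF f])
  fix x assume "x \<in> ends T"
  then obtain e where e: "e \<in> ends S" "x = f e" using img by blast
  have "?g (f (opp S e)) = opp S e" "?g (f (nxt S e)) = nxt S e" "?g (f e) = e"
    using e(1) closed by (simp_all add: the_inv_into_f_f[OF inj])
  then show "?g (opp T x) = opp S (?g x)" "?g (nxt T x) = nxt S (?g x)"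
    using hom[OF e(1)] e(2) by simp_all
qed

context free_product_subgroup
begin

interpretation H: subgroup H G by (rule H)

lemma lcosetsE: "C \<in> lcosets H \<Longrightarrow> (\<And>g. g \<in> carrier G \<Longrightarrow> C = g <# H \<Longrightarrow> thesis) \<Longrightarrow> thesis"
  by (auto simp: LCOSETS_def)

lemma lcosetsI: "g \<in> carrier G \<Longrightarrow> g <# H \<in> lcosets H"
  by (auto simp: LCOSETS_def)

lemma coset_action_facts:
  assumes "C \<in> lcosets H"
  shows "C \<subseteq> carrier G" "Y <# C \<in> lcosets H" "Y <# (Y <# C) = C"
    "inv X <# C \<in> lcosets H" "inv X <# (inv X <# (inv X <# C)) = C"
  using assms
  by (auto elim!: lcosetsE intro!: lcosetsI simp: lcos_m_assoc H.subset l_coset_subset_G)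
    (auto simp: l_coset_def dest: H.mem_carrier)

text \<open>
  A connected covering is the orbit of a point over the base coset, and by
  \<open>loops_lift_imp_stabilizer\<close> the subgroup \<open>H\<close> fixes this point.
\<close>

theorem covering_is_bijective:
  assumes gen: "generate G (H \<inter> conjugacy_class G (X \<otimes> Y)) = H"
    and op: "\<And>s. s \<in> S \<Longrightarrow> op s \<in> S" "\<And>s. s \<in> S \<Longrightarrow> op (op s) = s"
    and nx: "\<And>s. s \<in> S \<Longrightarrow> nx s \<in> S" "\<And>s. s \<in> S \<Longrightarrow> nx (nx (nx s)) = s"
    and conn: "s1 \<in> S" "\<And>A. s1 \<in> A \<Longrightarrow> (\<And>s. s \<in> A \<Longrightarrow> s \<in> S \<Longrightarrow> op s \<in> A) \<Longrightarrow>
      (\<And>s. s \<in> A \<Longrightarrow> s \<in> S \<Longrightarrow> nx s \<in> A) \<Longrightarrow> S \<subseteq> A"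
    and f: "\<And>s. s \<in> S \<Longrightarrow> f s \<in> lcosets H" "\<And>s. s \<in> S \<Longrightarrow> f (op s) = Y <# f s"
      "\<And>s. s \<in> S \<Longrightarrow> f (nx s) = inv X <# f s"
    and lift: "\<And>s. s \<in> S \<Longrightarrow> Y <# f s = inv X <# f s \<Longrightarrow> op s = nx s"
  shows "bij_betw f S (lcosets H)"
proof -
  obtain \<phi> where act: "group_action G S \<phi>"
    and \<phi>: "\<And>s. s \<in> S \<Longrightarrow> \<phi> (inv X) s = nx s" "\<And>s. s \<in> S \<Longrightarrow> \<phi> Y s = op s"
    using action_from_permutations[of S op nx, OF op nx] by blast
  note comp = group_action.composition_rule[OF act] and mem = group_action.element_image[OF act _ _ refl]
  have id: "\<phi> \<one> s = s" if "s \<in> S" for s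
    using group_action.id_eq_one[OF act] that by (metis restrict_apply')
  have f_sub: "f s \<subseteq> carrier G" if "s \<in> S" for s using coset_action_facts(1)[OF f(1)[OF that]] .
  have f_\<phi>: "f (\<phi> g s) = g <# f s" if "g \<in> carrier G" "s \<in> S" for g s
    by (rule equivariant_extend[OF act]) (use that f_sub f \<phi> in auto)
  have orbit: "S \<subseteq> {\<phi> g s1 | g. g \<in> carrier G}"
  proof (rule conn(2))
    show "s1 \<in> {\<phi> g s1 | g. g \<in> carrier G}" using id[OF conn(1)] one_closed by force
    fix s assume "s \<in> {\<phi> g s1 | g. g \<in> carrier G}" and s: "s \<in> S"
    then obtain g where g: "g \<in> carrier G" "s = \<phi> g s1" by blast
    have "op s = \<phi> (Y \<otimes> g) s1" "nx s = \<phi> (inv X \<otimes> g) s1"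
      using comp[OF conn(1)] g \<phi> s by auto
    moreover have "Y \<otimes> g \<in> carrier G" "inv X \<otimes> g \<in> carrier G" using g by simp_all
    ultimately show "op s \<in> {\<phi> g s1 | g. g \<in> carrier G}" "nx s \<in> {\<phi> g s1 | g. g \<in> carrier G}"
      by (metis (mono_tags, lifting) mem_Collect_eq)+
  qed
  obtain k where k: "k \<in> carrier G" "f s1 = k <# H" using f(1)[OF conn(1)] by (rule lcosetsE)
  \<comment> \<open>a point over the base coset\<close>
  define s0 where "s0 = \<phi> (inv k) s1"
  have s0: "s0 \<in> S" "f s0 = H"
    using k mem conn(1) f_\<phi>[of "inv k" s1] lcos_m_assoc[OF H.subset] lcos_mult_one[OF H.subset]
    by (simp_all add: s0_def)
  have orbit0: "\<exists>g\<in>carrier G. s = \<phi> g s0" if s: "s \<in> S" for s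
  proof -
    obtain g where g: "g \<in> carrier G" "s = \<phi> g s1" using orbit s by blast
    then have "s = \<phi> ((g \<otimes> k) \<otimes> inv k) s1" using k by (simp add: m_assoc)
    also have "\<dots> = \<phi> (g \<otimes> k) s0" using comp[OF conn(1), of "g \<otimes> k" "inv k"] g k by (simp add: s0_def)
    finally show ?thesis using g k by blast
  qed
  have f_\<phi>0: "f (\<phi> g s0) = g <# H" if "g \<in> carrier G" for g using f_\<phi>[OF that s0(1)] s0(2) by simp
  have "inj_on f S"
  proof (rule inj_onI)
    fix s t assume st: "s \<in> S" "t \<in> S" "f s = f t"
    obtain g where g: "g \<in> carrier G" "s = \<phi> g s0" using orbit0 st(1) by blast
    obtain g' where g': "g' \<in> carrier G" "t = \<phi> g' s0" using orbit0 st(2) by blast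
    have h: "inv g \<otimes> g' \<in> H" using coset_eq_iff[of g g'] g g' st(3) f_\<phi>0 by simp
    have stab: "\<phi> (inv g \<otimes> g') s0 = s0"
      by (rule loops_lift_imp_stabilizer[where f = f, OF gen act s0]) (use h f_sub f \<phi> lift in auto)
    have "t = \<phi> (g \<otimes> (inv g \<otimes> g')) s0" using g g' by (simp flip: m_assoc)
    also have "\<dots> = \<phi> g s0" using comp[OF s0(1), of g "inv g \<otimes> g'"] g g' stab by simp
    finally show "s = t" using g by simp
  qed
  moreover have "lcosets H \<subseteq> f ` S"
    using f_\<phi>0 mem s0(1) by (auto elim!: lcosetsE) (metis image_eqI)
  ultimately show ?thesis using f(1) by (auto simp: bij_betw_def)
qed

lemma loop_element_inj: "inj_on loop_element {g \<in> cut_tree. loop_end g}"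
proof (rule inj_onI)
  fix g k assume g: "g \<in> {g \<in> cut_tree. loop_end g}" and k: "k \<in> {g \<in> cut_tree. loop_end g}"
    and eq: "loop_element g = loop_element k"
  obtain \<phi> where \<phi>: "\<And>g w. g \<in> cut_tree \<Longrightarrow> loop_end g \<Longrightarrow> reduced_word w \<Longrightarrow>
      \<phi> (loop_element g) (\<one>, w) = (\<one>, push (True, g) w)"
    by (rule loop_word_action) blast
  have "\<phi> (loop_element g) (\<one>, []) = (\<one>, [(True, g)])" "\<phi> (loop_element k) (\<one>, []) = (\<one>, [(True, k)])"
    using \<phi>[of g "[]"] \<phi>[of k "[]"] g k by (simp_all add: push_def)
  then have "(\<one>, [(True, g)]) = (\<one>, [(True, k)])" unfolding eq by (rule trans[OF sym])
  then show "g = k" by simp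
qed

text \<open>
  Every loop is represented in the cut tree, so the loops are counted by the free basis.
\<close>

lemma finite_loops:
  assumes "loops_cut_to_tree" and S: "finite S" "generate G S = H"
  shows "finite {C \<in> lcosets H. Y <# C = inv X <# C}"
proof -
  have "finite loop_basis"
    by (rule finite_free_basis[OF loop_basis_closed loop_basis_free[OF assms(1)] S])
  then have fin: "finite {g \<in> cut_tree. loop_end g}"
    unfolding loop_basis_def by (rule finite_imageD[OF _ loop_element_inj])
  have "{C \<in> lcosets H. Y <# C = inv X <# C} \<subseteq> (\<lambda>g. g <# H) ` {g \<in> cut_tree. loop_end g}"
  proof
    fix C assume "C \<in> {C \<in> lcosets H. Y <# C = inv X <# C}"
    then obtain k where k: "k \<in> carrier G" "C = k <# H" and loop: "Y <# (k <# H) = inv X <# (k <# H)"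
      by (auto elim!: lcosetsE)
    obtain g h where gh: "g \<in> cut_tree" "h \<in> generate G loop_basis" "k = g \<otimes> h"
      using cut_tree_transversal[OF k(1)] by blast
    have g: "g \<in> carrier G" by (rule cut_tree_closed[OF gh(1)])
    have h: "h \<in> H" using gh(2) generate_loop_basis[OF assms(1)] by simp
    then have "inv g \<otimes> k \<in> H" using g gh(3) H.subset by (auto simp flip: m_assoc)
    then have eq: "g <# H = k <# H" using coset_eq_iff g k(1) by simp
    have "loop_end k" using loop k by (simp add: loop_end_def lcos_m_assoc H.subset)
    then have "loop_end g" using loop_end_cong[OF eq g k(1)] by simp
    then show "C \<in> (\<lambda>g. g <# H) ` {g \<in> cut_tree. loop_end g}" using gh(1) eq k(2) by blast
  qed
  then show ?thesis using fin by (auto intro: finite_subset)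
qed

text \<open>
  A nontrivial \<open>H\<close> contains a conjugate of \<open>X Y\<close>, which gives the loop where the exploration starts.
  The covering \<open>develop\<close> is injective before the tree is known to be finite, and its injectivity is
  used to show finiteness.
\<close>

theorem generated_imp_pseudo_tree:
  assumes gen: "generate G (H \<inter> conjugacy_class G (X \<otimes> Y)) = H" and nontrivial: "H \<noteq> {\<one>}"
    and S: "finite S" "generate G S = H"
  shows "\<exists>(\<Xi> :: nat ribbon) l. admissible_tree \<Xi> \<and> admissible_labelling \<Xi> l \<and>
    ribbon_iso coset_ribbon (Sk \<Xi> l)"
proof -
  have "H \<inter> conjugacy_class G (X \<otimes> Y) \<noteq> {}"
    using gen nontrivial generate_empty by auto
  then obtain k where k: "k \<in> carrier G" "k \<otimes> (X \<otimes> Y) \<otimes> inv k \<in> H"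
    by (auto simp: conjugacy_class_def)
  then have "inv k <# H = (X \<otimes> (Y \<otimes> inv k)) <# H"
    using coset_eq_iff[of "inv k" "X \<otimes> (Y \<otimes> inv k)"] by (simp add: m_assoc)
  then have "(inv X \<otimes> inv k) <# H = (Y \<otimes> inv k) <# H"
    using coset_mult_cong[of "inv k" "X \<otimes> (Y \<otimes> inv k)" "inv X"] k by simp
  then have base: "Y <# (inv k <# H) = inv X <# (inv k <# H)"
    using k by (simp add: lcos_m_assoc H.subset)
  \<comment> \<open>The coset of \<open>inv k\<close> is the first end of a loop.\<close>
  interpret looped_skeleton "lcosets H" "\<lambda>C. Y <# C" "\<lambda>C. inv X <# C" "inv k <# H"
  proof
    fix C assume C: "C \<in> lcosets H" and loop: "Y <# C = inv X <# C"
    obtain g where g: "g \<in> carrier G" "C = g <# H" using C by (rule lcosetsE)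
    show "inv X <# C \<noteq> C"
    proof
      assume fixed: "inv X <# C = C"
      then have Y: "(Y \<otimes> g) <# H = g <# H" and Xg: "(inv X \<otimes> g) <# H = g <# H"
        using loop g by (simp_all add: lcos_m_assoc H.subset)
      have "loop_end g" using Y Xg by (simp add: loop_end_def)
      moreover from this have "loop_end (Y \<otimes> g)" using loop_end_cong[OF Y] g by simp
      ultimately show False using not_loop_end_both g by blast
    qed
  qed (use coset_action_facts base k lcosetsI in auto)
  have bij: "bij_betw develop (ends spine_skeleton) (lcosets H)"
  proof (rule covering_is_bijective[where op = "sk_opp spine" and nx = "sk_nxt spine spine_label", OF gen])
    show "TreeEnd (end_at False []) \<in> ends spine_skeleton" by simp
    show "ends spine_skeleton \<subseteq> A" if "TreeEnd (end_at False []) \<in> A"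
      "\<And>u. u \<in> A \<Longrightarrow> u \<in> ends spine_skeleton \<Longrightarrow> sk_opp spine u \<in> A"
      "\<And>u. u \<in> A \<Longrightarrow> u \<in> ends spine_skeleton \<Longrightarrow> sk_nxt spine spine_label u \<in> A" for A
      using that by (rule spine_skeleton_closed_subset)
  qed (rule develop_closed spine_skeleton_opp spine_skeleton_nxt develop_loop_lifts; assumption)+
  have "finite (Collect tip)"
    using bij finite_loops[OF generated_imp_loops_cut_to_tree[OF gen] S]
    by (intro finite_tips) (auto simp: bij_betw_def)
  then have "admissible_tree spine" by (rule admissible_tree_spine)
  moreover have "ribbon_iso coset_ribbon spine_skeleton"
    by (rule ribbon_iso_sym[where f = develop])
      (use bij spine_skeleton_opp spine_skeleton_nxt in \<open>auto simp: coset_ribbon_def\<close>)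
  ultimately show ?thesis using admissible_labelling_spine by blast
qed

lemma coset_ribbon_action:
  "\<exists>\<phi>. transitive_action G (ends coset_ribbon) \<phi> \<and>
     (\<forall>e\<in>ends coset_ribbon. \<phi> X (nxt coset_ribbon e) = e \<and> \<phi> Y e = opp coset_ribbon e)"
proof -
  obtain \<phi> where act: "group_action G (lcosets H) \<phi>"
    and \<phi>: "\<And>C. C \<in> lcosets H \<Longrightarrow> \<phi> (inv X) C = inv X <# C" "\<And>C. C \<in> lcosets H \<Longrightarrow> \<phi> Y C = Y <# C"
    using action_from_permutations[of "lcosets H" "\<lambda>C. Y <# C" "\<lambda>C. inv X <# C"] coset_action_facts
    by blast
  have \<phi>_eq: "\<phi> g C = g <# C" if "g \<in> carrier G" "C \<in> lcosets H" for g C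
    using equivariant_extend[OF act, where f = "\<lambda>C. C"] coset_action_facts \<phi> that by blast
  have "\<exists>g\<in>carrier G. \<phi> g C = D" if CD: "C \<in> lcosets H" "D \<in> lcosets H" for C D
  proof -
    obtain a where a: "a \<in> carrier G" "C = a <# H" using CD(1) by (rule lcosetsE)
    obtain b where b: "b \<in> carrier G" "D = b <# H" using CD(2) by (rule lcosetsE)
    have "\<phi> (b \<otimes> inv a) C = D" using \<phi>_eq a b CD by (simp add: lcos_m_assoc H.subset m_assoc)
    then show ?thesis using a b by blast
  qed
  then have "transitive_action G (lcosets H) \<phi>"
    using act by (simp add: transitive_action_def transitive_action_axioms_def)
  moreover have "\<phi> X (inv X <# C) = C" if "C \<in> lcosets H" for C
    using that coset_action_facts(1,4)[OF that] \<phi>_eq lcos_m_assoc lcos_mult_one by simp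
  ultimately show ?thesis using \<phi> by (auto simp: coset_ribbon_def)
qed

lemma coset_ribbon_permutations:
  "bij_betw (opp coset_ribbon) (ends coset_ribbon) (ends coset_ribbon)"
  "bij_betw (nxt coset_ribbon) (ends coset_ribbon) (ends coset_ribbon)"
proof -
  show "bij_betw (opp coset_ribbon) (ends coset_ribbon) (ends coset_ribbon)"
    by (rule bij_betwI[where g = "opp coset_ribbon"]) (auto simp: coset_ribbon_def coset_action_facts)
  show "bij_betw (nxt coset_ribbon) (ends coset_ribbon) (ends coset_ribbon)"
    by (rule bij_betwI[where g = "\<lambda>C. nxt coset_ribbon (nxt coset_ribbon C)"])
      (auto simp: coset_ribbon_def coset_action_facts)
qed

end

theorem proposition4p4p1:
  fixes H :: "(int^2^2) set set"
  assumes "finitely_generated_subgroup PSL2Z H"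
    and "H \<noteq> {\<one>\<^bsub>PSL2Z\<^esub>}"
    and "H \<noteq> carrier PSL2Z"
  defines "C \<equiv> conjugacy_class PSL2Z (genX \<otimes>\<^bsub>PSL2Z\<^esub> genY)"
  shows "(generate PSL2Z (H \<inter> C) = H \<longleftrightarrow> generalized_pseudo_tree (coset_skeleton H)) \<and>
    (generate PSL2Z (H \<inter> C) = H \<longrightarrow> (\<exists>B. B \<subseteq> C \<and> free_basis PSL2Z H B))"
proof -
  interpret free_product_3_2 PSL2Z genX genY by (rule PSL2Z_free_product)
  obtain S where H: "subgroup H PSL2Z" and S: "finite S" "generate PSL2Z S = H"
    using assms(1) by (auto simp: finitely_generated_subgroup_def)
  interpret free_product_subgroup PSL2Z genX genY H
    by (intro free_product_subgroup.intro free_product_subgroup_axioms.intro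
        PSL2Z_free_product H assms(3))
  have skeleton: "coset_skeleton H = coset_ribbon"
    by (simp add: coset_skeleton_def coset_ribbon_def)
  have "generalized_skeleton coset_ribbon"
    unfolding generalized_skeleton_def
    using coset_ribbon_permutations coset_ribbon_action lcosetsI[OF one_closed]
    by (auto simp: coset_ribbon_def coset_action_facts)
  then have pseudo_tree: "generalized_pseudo_tree (coset_skeleton H)" if "generate PSL2Z (H \<inter> C) = H"
    using generated_imp_pseudo_tree[OF that[unfolded C_def] assms(2) S]
    by (simp add: generalized_pseudo_tree_def skeleton)
  have generated: "generate PSL2Z (H \<inter> C) = H" if "generalized_pseudo_tree (coset_skeleton H)"
  proof -
    have "loops_cut_to_tree"
      using that pseudo_tree_imp_loops_cut_to_tree by (auto simp: generalized_pseudo_tree_def skeleton)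
    then have "H = generate PSL2Z loop_basis" by (rule generate_loop_basis[symmetric])
    also have "\<dots> \<subseteq> generate PSL2Z (H \<inter> C)" unfolding C_def by (rule mono_generate[OF loop_basis_subset])
    finally show ?thesis using generate_subgroup_incl[OF _ H, of "H \<inter> C"] by auto
  qed
  have "\<exists>B. B \<subseteq> C \<and> free_basis PSL2Z H B" if "generate PSL2Z (H \<inter> C) = H"
    using loop_basis_free[OF generated_imp_loops_cut_to_tree[OF that[unfolded C_def]]] loop_basis_subset
    unfolding C_def by blast
  then show ?thesis using pseudo_tree generated by blast
qed

end
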